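(* Let $C=\int_0^\infty\log_2(1+\gamma)f_\gamma(\gamma)\,d\gamma$ be the average capacity (with normalized bandwidth $1$) of the normalized SOSF fading channel with parameters $(\alpha,\beta)$ and average SNR $\bar\gamma$, where $f_\gamma$ is the PDF of its instantaneous SNR. For the special cases of the SOSF channel, the asymptotic average capacity in the high-SNR regime (large $\bar\gamma$) has the following closed forms. (i) Rice ($\alpha=0$): $$C\big|_{\bar\gamma\Uparrow}\approx\log_2(\bar\gamma)+\log_2(\beta)+\log_2(e)\,E_1\!\left(\frac{\beta}{1-\beta}\right).$$ (ii) Double-Rayleigh and LOS ($\alpha+\beta=1$): $$C\big|_{\bar\gamma\Uparrow}\approx\log_2(\bar\gamma)+\log_2(\beta)+2\log_2(e)\,K_0\!\left(2\sqrt{\frac{\beta}{1-\beta}}\right).$$ (iii) Rayleigh and double-Rayleigh ($\beta=0$): $$C\big|_{\bar\gamma\Uparrow}\approx\log_2(\bar\gamma)-\log_2(e)\,\gamma_e+\log_2(1-\alpha)+\log_2(e)\,e^{\frac{1-\alpha}{\alpha}}E_1\!\left(\frac{1-\alpha}{\alpha}\right).$$ (iv) Rayleigh ($\alpha=0$, $\beta=0$): $$C\big|_{\bar\gamma\Uparrow}\approx\log_2(\bar\gamma)-\log_2(e)\,\gamma_e.$$ (v) Double-Rayleigh ($\alpha=1$, $\beta=0$): $$C\big|_{\bar\gamma\Uparrow}\approx\log_2(\bar\gamma)-2\log_2(e)\,\gamma_e.$$ (vi) AWGN, i.e. the static case ($\alpha=0$, $\beta=1$): $$C\big|_{\bar\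gamma\Uparrow}\approx\log_2(\bar\gamma).$$
   Context: SOSF (second order scattering fading) channel: $S=\omega_0e^{j\phi}+\omega_1G_1+\omega_2G_2G_3$, where $j$ is the imaginary unit, $\omega_0,\omega_1,\omega_2\ge 0$ are real constants with $\omega_0^2+\omega_1^2+\omega_2^2=1$, $\phi$ is uniform on $[0,2\pi)$, and $G_1,G_2,G_3$ are circularly-symmetric complex Gaussian random variables with mean $0$ and variance $\mathbb{E}|G_i|^2=1$; $\phi,G_1,G_2,G_3$ are mutually independent. The parameters are $\alpha=\omega_2^2$ and $\beta=\omega_0^2$ (so $\omega_1^2=1-\alpha-\beta$), with $\alpha\ge0$, $\beta\ge0$, $\alpha+\beta\le1$. The instantaneous SNR is $\gamma=\bar\gamma|S|^2$, so that $\mathbb{E}(\gamma)=\bar\gamma$. LOS means line-of-sight. $E_1(x)=\int_x^\infty \frac{e^{-z}}{z}\,dz$ is the exponential integral, $K_0$ is the modified Bessel function of the second kind of order zero, and $\gamma_e$ is the Euler–Mascheroni constant. The notation $C|_{\bar\gamma\Uparrow}\approx\cdots$ denotes the high-SNR approximation of the capacity. *)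

theory Defs
  imports "HOL-Probability.Probability"
begin

text \<open>The joint density of the real and imaginary parts: independent centred normals of
  variance \<open>v / 2\<close> each, so that the expectation of \<open>(cmod (G x))\<^sup>2\<close> is \<open>v\<close>.\<close>

definition cs_complex_gaussian :: "'a measure \<Rightarrow> real \<Rightarrow> ('a \<Rightarrow> complex) \<Rightarrow> bool" where
  "cs_complex_gaussian M v G \<longleftrightarrow>
     distributed M lborel G
       (\<lambda>z. ennreal (normal_density 0 (sqrt (v / 2)) (Re z) * normal_density 0 (sqrt (v / 2)) (Im z)))"

text \<open>\<open>indep_vars\<close> needs a common codomain, so the real phase is embedded into the complex
  numbers; the embedding generates the same sigma-algebra as the phase itself.\<close>

definition sosf_channel ::
  "'a measure \<Rightarrow> ('a \<Rightarrow> real) \<Rightarrow> ('a \<Rightarrow> complex) \<Rightarrow> ('a \<Rightarrow> complex) \<Rightarrow> ('a \<Rightarrow> complex) \<Rightarrow>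
     real \<Rightarrow> real \<Rightarrow> real \<Rightarrow> bool" where
  "sosf_channel M \<phi> G1 G2 G3 \<omega>0 \<omega>1 \<omega>2 \<longleftrightarrow>
     prob_space M \<and>
     0 \<le> \<omega>0 \<and> 0 \<le> \<omega>1 \<and> 0 \<le> \<omega>2 \<and> \<omega>0\<^sup>2 + \<omega>1\<^sup>2 + \<omega>2\<^sup>2 = 1 \<and>
     \<phi> \<in> borel_measurable M \<and> distr M borel \<phi> = uniform_measure lborel {0..<2 * pi} \<and>
     cs_complex_gaussian M 1 G1 \<and> cs_complex_gaussian M 1 G2 \<and> cs_complex_gaussian M 1 G3 \<and>
     prob_space.indep_vars M (\<lambda>_. borel) (\<lambda>k::nat. [\<lambda>x. complex_of_real (\<phi> x), G1, G2, G3] ! k) {..<4}"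

definition sosf_signal ::
  "('a \<Rightarrow> real) \<Rightarrow> ('a \<Rightarrow> complex) \<Rightarrow> ('a \<Rightarrow> complex) \<Rightarrow> ('a \<Rightarrow> complex) \<Rightarrow>
     real \<Rightarrow> real \<Rightarrow> real \<Rightarrow> 'a \<Rightarrow> complex" where
  "sosf_signal \<phi> G1 G2 G3 \<omega>0 \<omega>1 \<omega>2 x =
     complex_of_real \<omega>0 * exp (\<i> * complex_of_real (\<phi> x)) + complex_of_real \<omega>1 * G1 x
       + complex_of_real \<omega>2 * G2 x * G3 x"

definition inst_snr :: "real \<Rightarrow> ('a \<Rightarrow> complex) \<Rightarrow> 'a \<Rightarrow> real" where
  "inst_snr \<gamma>bar S x = \<gamma>bar * (cmod (S x))\<^sup>2"

text \<open>The integral is taken against the law of the SNR rather than against a density, because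
  in the static case the SNR is deterministic and its law has no density with respect to Lebesgue
  measure. Whenever a density \<open>f\<close> exists, this is the integral of \<open>log 2 (1 + g) * f g\<close>
  over \<open>{0..}\<close> (\<open>avg_capacity_pdf\<close>).\<close>

definition avg_capacity :: "'a measure \<Rightarrow> ('a \<Rightarrow> real) \<Rightarrow> real" where
  "avg_capacity M \<gamma> = (LINT g:{0..}|distr M borel \<gamma>. log 2 (1 + g))"

lemma avg_capacity_pdf:
  fixes f :: "real \<Rightarrow> real"
  assumes "distributed M lborel \<gamma> (\<lambda>g. ennreal (f g))" and "\<And>g. 0 \<le> f g"
  shows "avg_capacity M \<gamma> = (LBINT g:{0..}. log 2 (1 + g) * f g)"
proof -
  have f: "f \<in> borel_measurable lborel"
    using distributed_real_measurable[OF _ assms(1)] assms(2) by simp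
  have "distr M borel \<gamma> = density lborel (\<lambda>g. ennreal (f g))"
    using distributed_distr_eq_density[OF assms(1)] by (simp cong: distr_cong)
  then have "avg_capacity M \<gamma> =
      (LINT g|density lborel (\<lambda>g. ennreal (f g)). indicator {0..} g *\<^sub>R log 2 (1 + g))"
    by (simp add: avg_capacity_def set_lebesgue_integral_def)
  also have "\<dots> = (LINT g|lborel. f g *\<^sub>R (indicator {0..} g *\<^sub>R log 2 (1 + g)))"
    by (rule integral_density) (use f assms(2) in auto)
  also have "\<dots> = (LBINT g:{0..}. log 2 (1 + g) * f g)"
    by (simp add: set_lebesgue_integral_def mult_ac)
  finally show ?thesis .
qed

definition high_snr_approx :: "(real \<Rightarrow> real) \<Rightarrow> (real \<Rightarrow> real) \<Rightarrow> bool" where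
  "high_snr_approx C R \<longleftrightarrow> ((\<lambda>\<gamma>bar. C \<gamma>bar - R \<gamma>bar) \<longlongrightarrow> 0) at_top"

definition exp_integral_E1 :: "real \<Rightarrow> real" where
  "exp_integral_E1 x = (LBINT z:{x..}. exp (- z) / z)"

text \<open>Modified Bessel function of the second kind, for positive argument, by its standard
  integral representation.\<close>

definition bessel_K :: "real \<Rightarrow> real \<Rightarrow> real" where
  "bessel_K \<nu> x = (LBINT t:{0..}. exp (- x * cosh t) * cosh (\<nu> * t))"

end

theory Submission
  imports Defs "HOL-Complex_Analysis.Complex_Analysis"
begin

text \<open>By dominated convergence \<open>C - log\<^sub>2 \<gamma>bar\<close> tends to \<open>E (log\<^sub>2 \<bar>S\<bar>\<^sup>2)\<close>, provided that
  \<open>ln \<bar>S\<bar>\<^sup>2\<close> is integrable. In the cases that need work \<open>S = A + B G\<close> with \<open>G\<close> Gaussian and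
  independent of \<open>(A, B)\<close>. The law of \<open>G\<close> is invariant under rotations, so Jensen's formula gives
  \<open>E (ln \<bar>S\<bar>\<^sup>2) = E (ln (max (\<bar>A\<bar>\<^sup>2) (\<bar>B G\<bar>\<^sup>2)))\<close>. Only the squared moduli \<open>\<bar>G\<^sub>i\<bar>\<^sup>2\<close> are left; they
  are independent standard exponential variables, and \<open>E (ln\<^sup>+ W) = \<integral>\<^sub>1\<^sup>\<infinity> P (W \<ge> t) / t dt\<close> produces
  \<open>E\<^sub>1\<close> and \<open>K\<^sub>0\<close>, while \<open>E (ln \<bar>G\<bar>\<^sup>2) = \<Gamma>' 1 = - \<gamma>\<^sub>e\<close>.\<close>

section \<open>The complex Gaussian law\<close>

text \<open>The logarithm has its singularity at the zeros of the signal, and since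
  \<open>ln 0 = 0\<close> in HOL a zero is invisible in \<open>ln ((cmod (S x))\<^sup>2)\<close>.
  The passage to the limit therefore needs two facts about \<open>S\<close>: integrability of the
  logarithm, and \<open>S x \<noteq> 0\<close> almost everywhere. Both come out of the same
  averaging argument.

  Averaging over a rotation of one Gaussian factor also avoids the density of the SNR. For the Rice
  channel that density contains the Bessel function \<open>I\<close> of order zero. After averaging,
  the phase and all arguments are gone, and only a maximum of two squared moduli is left.

  The role of \<open>A + B G\<close> is that all randomness except one Gaussian factor can be
  frozen: for fixed \<open>A\<close> and \<open>B\<close>, the value \<open>B G\<close> is spread
  uniformly over circles around 0. The mean of \<open>ln \<bar>w + z\<bar>\<close> over a circle
  \<open>\<bar>z\<bar> = \<bar>v\<bar>\<close> is
  \<open>ln (max \<bar>w\<bar> \<bar>v\<bar>)\<close>, because the logarithm of the modulus is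
  harmonic away from 0.\<close>

lemma measurable_Complex [measurable]:
  assumes [measurable]: "f \<in> borel_measurable M" "g \<in> borel_measurable M"
  shows "(\<lambda>x. Complex (f x) (g x)) \<in> borel_measurable M"
  unfolding Complex_eq by measurable

section \<open>Lebesgue measure on the complex plane: Fubini, shears, rotations\<close>

lemma lborel_complex_eq:
  "(lborel :: complex measure) = distr (lborel \<Otimes>\<^sub>M lborel) borel (\<lambda>(x, y). Complex x y)"
proof (rule lborel_eqI)
  fix l u :: complex
  assume le: "\<And>b. b \<in> Basis \<Longrightarrow> l \<bullet> b \<le> u \<bullet> b"
  have le': "Re l \<le> Re u" "Im l \<le> Im u"
    using le[of 1] le[of \<i>] by (auto simp: Basis_complex_def)
  have vim: "(\<lambda>(x, y). Complex x y) -` box l u \<inter> space (lborel \<Otimes>\<^sub>M lborel)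
      = {Re l<..<Re u} \<times> {Im l<..<Im u}"
    by (auto simp: box_def Basis_complex_def space_pair_measure)
  show "emeasure (distr (lborel \<Otimes>\<^sub>M lborel) borel (\<lambda>(x, y). Complex x y)) (box l u)
      = ennreal (prod ((\<bullet>) (u - l)) Basis)"
    using le' by (simp add: emeasure_distr vim lborel.emeasure_pair_measure_Times
        ennreal_mult Basis_complex_def)
qed simp

lemma nn_integral_lborel_complex:
  assumes [measurable]: "f \<in> borel_measurable borel"
  shows "(\<integral>\<^sup>+z. f z \<partial>lborel) = (\<integral>\<^sup>+x. \<integral>\<^sup>+y. f (Complex x y) \<partial>lborel \<partial>lborel)"
  by (subst lborel_complex_eq)
    (simp add: nn_integral_distr lborel.nn_integral_fst[symmetric] case_prod_beta)

lemma nn_integral_lborel_complex':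
  assumes [measurable]: "f \<in> borel_measurable borel"
  shows "(\<integral>\<^sup>+z. f z \<partial>lborel) = (\<integral>\<^sup>+y. \<integral>\<^sup>+x. f (Complex x y) \<partial>lborel \<partial>lborel)"
  using lborel_pair.Fubini'[of "\<lambda>x y. f (Complex x y)"] by (simp add: nn_integral_lborel_complex)

text \<open>Reflection carries the negative half-line to the positive one, up to the null set
  consisting of 0. It serves both the radial integration and the passage from the whole line to the
  half-line for \<open>cosh\<close>.\<close>

lemma nn_integral_lborel_even:
  fixes f :: "real \<Rightarrow> ennreal"
  assumes [measurable]: "f \<in> borel_measurable borel" and even: "\<And>x. f (- x) = f x"
  shows "(\<integral>\<^sup>+x. f x \<partial>lborel) = 2 * (\<integral>\<^sup>+x\<in>{0..}. f x \<partial>lborel)"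
proof -
  have "(\<integral>\<^sup>+x. f x \<partial>lborel) = (\<integral>\<^sup>+x\<in>{0..}. f x \<partial>lborel) + (\<integral>\<^sup>+x\<in>{..<0}. f x \<partial>lborel)"
    by (subst nn_integral_add[symmetric]) (auto intro!: nn_integral_cong split: split_indicator)
  also have "(\<integral>\<^sup>+x\<in>{..<0}. f x \<partial>lborel) = (\<integral>\<^sup>+x. f x * indicator {..<0} (- x) \<partial>lborel)"
    by (subst nn_integral_real_affine[where t=0 and c="-1"]) (auto simp: even)
  also have "\<dots> = (\<integral>\<^sup>+x\<in>{0..}. f x \<partial>lborel)"
    by (rule nn_integral_cong_AE, use AE_lborel_singleton[of "0::real"] in eventually_elim)
       (auto split: split_indicator)
  finally show ?thesis by (simp add: mult_2)
qed

text \<open>A rotation by an angle different from \<open>\<pi>\<close> is a product of three shears, and a shear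
  preserves Lebesgue measure by Fubini and translation invariance.\<close>

lemma nn_integral_shear1:
  assumes [measurable]: "f \<in> borel_measurable borel"
  shows "(\<integral>\<^sup>+z. f (Complex (Re z + a * Im z) (Im z)) \<partial>lborel) = (\<integral>\<^sup>+z. f z \<partial>lborel)"
proof -
  have "(\<integral>\<^sup>+x. f (Complex (x + a * y) y) \<partial>lborel) = (\<integral>\<^sup>+x. f (Complex x y) \<partial>lborel)" for y
    by (subst (2) nn_integral_real_affine[where t="a * y" and c=1]) (auto simp: add.commute)
  then show ?thesis by (simp add: nn_integral_lborel_complex')
qed

lemma nn_integral_shear2:
  assumes [measurable]: "f \<in> borel_measurable borel"
  shows "(\<integral>\<^sup>+z. f (Complex (Re z) (Im z + a * Re z)) \<partial>lborel) = (\<integral>\<^sup>+z. f z \<partial>lborel)"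
proof -
  have "(\<integral>\<^sup>+y. f (Complex x (y + a * x)) \<partial>lborel) = (\<integral>\<^sup>+y. f (Complex x y) \<partial>lborel)" for x
    by (subst (2) nn_integral_real_affine[where t="a * x" and c=1]) (auto simp: add.commute)
  then show ?thesis by (simp add: nn_integral_lborel_complex)
qed

lemma nn_integral_lborel_rotate:
  fixes f :: "complex \<Rightarrow> ennreal"
  assumes [measurable]: "f \<in> borel_measurable borel" and u: "cmod u = 1"
  shows "(\<integral>\<^sup>+z. f (u * z) \<partial>lborel) = (\<integral>\<^sup>+z. f z \<partial>lborel)"
proof -
  have *: "(\<integral>\<^sup>+z. f (u * z) \<partial>lborel) = (\<integral>\<^sup>+z. f z \<partial>lborel)"
    if u: "cmod u = 1" "u \<noteq> -1" and [measurable]: "f \<in> borel_measurable borel"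
    for u and f :: "complex \<Rightarrow> ennreal"
  proof -
    \<comment> \<open>For \<open>u\<close> of argument \<theta>, \<open>a\<close> is minus the
      tangent of \<theta>/2. The rotation is the horizontal shear by \<open>a\<close>, then the
      vertical shear by \<open>s\<close>, then the horizontal shear by \<open>a\<close> again. The
      half-angle tangent has a pole at \<open>u = -1\<close>, which is why that angle is treated
      apart, as two quarter turns.\<close>
    define s c a where "s = Im u" and "c = Re u" and "a = - s / (1 + c)"
    have sc: "s\<^sup>2 + c\<^sup>2 = 1"
      using u(1) by (simp add: s_def c_def cmod_def add.commute)
    have c: "c \<noteq> -1"
      using u sc by (auto simp: s_def c_def complex_eq_iff)
    have as: "1 + a * s = c"
      using c sc by (simp add: a_def divide_simps) (algebra)
    have aas: "2 * a + a * a * s = - s"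
      using c sc by (simp add: a_def divide_simps) (algebra)
    let ?g = "\<lambda>z. f (Complex (Re z + a * Im z) (Im z))"
    let ?h = "\<lambda>z. ?g (Complex (Re z) (Im z + s * Re z))"
    have "f (u * z) = ?h (Complex (Re z + a * Im z) (Im z))" for z
    proof -
      have "u * z = Complex (c * Re z - s * Im z) (s * Re z + c * Im z)"
        by (simp add: complex_eq_iff s_def c_def)
      also have "c * Re z - s * Im z = (1 + a * s) * Re z + (2 * a + a * a * s) * Im z"
        unfolding as aas by simp
      also have "\<dots> = Re z + a * Im z + a * (Im z + s * (Re z + a * Im z))"
        by (simp add: algebra_simps)
      also have "s * Re z + c * Im z = Im z + s * (Re z + a * Im z)"
        unfolding as[symmetric] by (simp add: algebra_simps)
      finally show ?thesis by simp
    qed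
    then have "(\<integral>\<^sup>+z. f (u * z) \<partial>lborel) = (\<integral>\<^sup>+z. ?h (Complex (Re z + a * Im z) (Im z)) \<partial>lborel)"
      by simp
    also have "\<dots> = (\<integral>\<^sup>+z. ?h z \<partial>lborel)" by (rule nn_integral_shear1) measurable
    also have "\<dots> = (\<integral>\<^sup>+z. ?g z \<partial>lborel)" by (rule nn_integral_shear2) measurable
    also have "\<dots> = (\<integral>\<^sup>+z. f z \<partial>lborel)" by (rule nn_integral_shear1) measurable
    finally show ?thesis .
  qed
  show ?thesis
  proof (cases "u = -1")
    case True
    have "(\<integral>\<^sup>+z. f (\<i> * (\<i> * z)) \<partial>lborel) = (\<integral>\<^sup>+z. f (\<i> * z) \<partial>lborel)"
      by (rule *) (auto simp: complex_eq_iff)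
    also have "\<dots> = (\<integral>\<^sup>+z. f z \<partial>lborel)"
      by (rule *) (auto simp: complex_eq_iff)
    finally show ?thesis using True by (simp add: mult.assoc[symmetric])
  qed (use * u in auto)
qed

section \<open>The standard complex Gaussian: rotation invariance and the law of its squared
  modulus\<close>

lemma cs_complex_gaussian_density:
  "normal_density 0 (sqrt (1 / 2)) (Re z) * normal_density 0 (sqrt (1 / 2)) (Im z)
    = exp (- (cmod z)\<^sup>2) / pi"
  by (simp add: normal_density_def cmod_power2 real_sqrt_divide power_divide flip: exp_add)

lemma (in prob_space) nn_integral_cs_complex_gaussian:
  assumes G: "cs_complex_gaussian M 1 G" and [measurable]: "f \<in> borel_measurable borel"
  shows "(\<integral>\<^sup>+x. f (G x) \<partial>M) = (\<integral>\<^sup>+z. ennreal (exp (- (cmod z)\<^sup>2) / pi) * f z \<partial>lborel)"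
  using distributed_nn_integral[OF G[unfolded cs_complex_gaussian_def], of f]
  by (simp only: cs_complex_gaussian_density)  simp

text \<open>The density depends on the modulus alone and Lebesgue measure is invariant under
  rotation, so the whole law is.\<close>

lemma (in prob_space) nn_integral_cs_complex_gaussian_rotate:
  assumes G: "cs_complex_gaussian M 1 G" and f[measurable]: "f \<in> borel_measurable borel"
    and u: "cmod u = 1"
  shows "(\<integral>\<^sup>+x. f (u * G x) \<partial>M) = (\<integral>\<^sup>+x. f (G x) \<partial>M)"
proof -
  have "(\<integral>\<^sup>+x. f (u * G x) \<partial>M)
     = (\<integral>\<^sup>+z. ennreal (exp (- (cmod (u * z))\<^sup>2) / pi) * f (u * z) \<partial>lborel)"
    using u by (subst nn_integral_cs_complex_gaussian[OF G]) (auto simp: norm_mult)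
  also have "\<dots> = (\<integral>\<^sup>+z. ennreal (exp (- (cmod z)\<^sup>2) / pi) * f z \<partial>lborel)"
    by (rule nn_integral_lborel_rotate[OF _ u]) measurable
  also have "\<dots> = (\<integral>\<^sup>+x. f (G x) \<partial>M)"
    by (rule nn_integral_cs_complex_gaussian[OF G f, symmetric])
  finally show ?thesis .
qed

text \<open>Substituting \<open>y = x * s\<close> turns \<open>x\<^sup>2 + y\<^sup>2\<close> into \<open>x\<^sup>2 * (1 + s\<^sup>2)\<close>, which replaces polar
  coordinates.\<close>

lemma nn_integral_lborel_radial:
  fixes f :: "real \<Rightarrow> ennreal"
  assumes [measurable]: "f \<in> borel_measurable borel"
  shows "(\<integral>\<^sup>+z. f ((cmod z)\<^sup>2) \<partial>lborel) =
    (\<integral>\<^sup>+s. 2 * (\<integral>\<^sup>+x\<in>{0..}. ennreal x * f (x\<^sup>2 * (1 + s\<^sup>2)) \<partial>lborel) \<partial>lborel)"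
proof -
  have "(\<integral>\<^sup>+z. f ((cmod z)\<^sup>2) \<partial>lborel) = (\<integral>\<^sup>+x. \<integral>\<^sup>+y. f (x\<^sup>2 + y\<^sup>2) \<partial>lborel \<partial>lborel)"
    by (simp add: nn_integral_lborel_complex cmod_power2)
  also have "\<dots> = (\<integral>\<^sup>+x. \<integral>\<^sup>+s. ennreal \<bar>x\<bar> * f (x\<^sup>2 * (1 + s\<^sup>2)) \<partial>lborel \<partial>lborel)"
  proof (rule nn_integral_cong_AE, use AE_lborel_singleton[of "0::real"] in eventually_elim)
    fix x :: real assume "x \<noteq> 0"
    then show "(\<integral>\<^sup>+y. f (x\<^sup>2 + y\<^sup>2) \<partial>lborel) = (\<integral>\<^sup>+s. ennreal \<bar>x\<bar> * f (x\<^sup>2 * (1 + s\<^sup>2)) \<partial>lborel)"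
      by (subst nn_integral_real_affine[where t=0 and c=x])
         (auto simp: nn_integral_cmult power_mult_distrib algebra_simps)
  qed
  also have "\<dots> = (\<integral>\<^sup>+s. \<integral>\<^sup>+x. ennreal \<bar>x\<bar> * f (x\<^sup>2 * (1 + s\<^sup>2)) \<partial>lborel \<partial>lborel)"
    by (subst lborel_pair.Fubini') auto
  also have "\<dots> = (\<integral>\<^sup>+s. 2 * (\<integral>\<^sup>+x\<in>{0..}. ennreal x * f (x\<^sup>2 * (1 + s\<^sup>2)) \<partial>lborel) \<partial>lborel)"
    by (subst nn_integral_lborel_even)
       (auto intro!: nn_integral_cong arg_cong[where f="(*) 2"] split: split_indicator)
  finally show ?thesis .
qed

text \<open>In the coordinates given by \<open>x\<close> and the slope \<open>s\<close>, the density
  acquires a factor \<open>x\<close> and hence an elementary antiderivative in \<open>x\<close>.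
  Cutting off at \<open>a\<close> multiplies the result by \<open>1 - exp (- a)\<close> for every
  slope, so the distribution function is that factor times the total mass.\<close>

lemma (in prob_space) cs_complex_gaussian_exponential:
  assumes G: "cs_complex_gaussian M 1 G"
  shows "distributed M lborel (\<lambda>x. (cmod (G x))\<^sup>2) (\<lambda>x. ennreal (exponential_density 1 x))"
proof (rule exponential_distributedI)
  have [measurable]: "G \<in> borel_measurable M"
    using G by (auto simp: cs_complex_gaussian_def distributed_def)
  show "(\<lambda>x. (cmod (G x))\<^sup>2) \<in> borel_measurable M" by measurable
  \<comment> \<open>The mass of the Cauchy density. Its value 1 is read off from the total
    probability of \<open>G\<close>, with no arctangent computed.\<close>
  define K where "K = (\<integral>\<^sup>+s. ennreal (1 / (pi * (1 + s\<^sup>2))) \<partial>lborel)"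
  have deriv: "((\<lambda>x. - exp (- (x\<^sup>2 * c)) / (2 * pi * c)) has_real_derivative x
      * (exp (- (x\<^sup>2 * c)) / pi)) (at x within A)"
    if "c > 0" for c x A
    using that by (auto intro!: derivative_eq_intros simp: field_simps)
  have pos: "1 + s\<^sup>2 > 0" for s :: real by (simp add: add_pos_nonneg)
  have "1 = (\<integral>\<^sup>+x. 1 \<partial>M)" by (simp add: emeasure_space_1)
  also have "\<dots> = (\<integral>\<^sup>+z. ennreal (exp (- (cmod z)\<^sup>2) / pi) \<partial>lborel)"
    using nn_integral_cs_complex_gaussian[OF G, of "\<lambda>_. 1"] by simp
  also have "\<dots> = (\<integral>\<^sup>+s. 2
      * (\<integral>\<^sup>+x\<in>{0..}. ennreal x * ennreal (exp (- (x\<^sup>2 * (1 + s\<^sup>2))) / pi) \<partial>lborel) \<partial>lborel)"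
    by (rule nn_integral_lborel_radial) measurable
  also have "\<dots> = K"
    unfolding K_def
  proof (intro nn_integral_cong)
    fix s :: real
    have "(\<integral>\<^sup>+x\<in>{0..}. ennreal x * ennreal (exp (- (x\<^sup>2 * (1 + s\<^sup>2))) / pi) \<partial>lborel) =
      (\<integral>\<^sup>+x\<in>{0..}. ennreal (x * (exp (- (x\<^sup>2 * (1 + s\<^sup>2))) / pi)) \<partial>lborel)"
      by (auto intro!: nn_integral_cong simp: ennreal_mult[symmetric] split: split_indicator)
    also have "\<dots> = ennreal (0 - (- exp (- (0\<^sup>2 * (1 + s\<^sup>2))) / (2 * pi * (1 + s\<^sup>2))))"
    proof (rule nn_integral_FTC_atLeast)
      show "((\<lambda>x. - exp (- (x\<^sup>2 * (1 + s\<^sup>2))) / (2 * pi * (1 + s\<^sup>2))) \<longlongrightarrow> 0) at_top"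
        using pos[of s] by real_asymp
    qed (use deriv pos in auto)
    finally show "2 * (\<integral>\<^sup>+x\<in>{0..}. ennreal x * ennreal (exp (- (x\<^sup>2 * (1 + s\<^sup>2))) / pi) \<partial>lborel)
      = ennreal (1 / (pi * (1 + s\<^sup>2)))"
      using pos[of s] by (simp add: ennreal_mult[symmetric] flip: ennreal_numeral)
  qed
  finally have K: "K = 1" by simp
  fix a :: real assume a: "0 \<le> a"
  have "emeasure M {x \<in> space M. (cmod (G x))\<^sup>2 \<le> a}
      = (\<integral>\<^sup>+x. indicator {..a} ((cmod (G x))\<^sup>2) \<partial>M)"
  proof -
    have "(\<integral>\<^sup>+x. indicator {..a} ((cmod (G x))\<^sup>2) \<partial>M)
        = (\<integral>\<^sup>+x. indicator {x \<in> space M. (cmod (G x))\<^sup>2 \<le> a} x \<partial>M)"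
      by (intro nn_integral_cong) (auto split: split_indicator)
    also have "\<dots> = emeasure M {x \<in> space M. (cmod (G x))\<^sup>2 \<le> a}"
      by (rule nn_integral_indicator) measurable
    finally show ?thesis by simp
  qed
  also have "\<dots> = (\<integral>\<^sup>+z. ennreal (exp (- (cmod z)\<^sup>2) / pi) * indicator {..a} ((cmod z)\<^sup>2) \<partial>lborel)"
    by (rule nn_integral_cs_complex_gaussian[OF G]) measurable
  also have "\<dots> = (\<integral>\<^sup>+s. 2 * (\<integral>\<^sup>+x\<in>{0..}. ennreal x *
     (ennreal (exp (- (x\<^sup>2 * (1 + s\<^sup>2))) / pi) * indicator {..a} (x\<^sup>2 * (1 + s\<^sup>2))) \<partial>lborel) \<partial>lborel)"
    by (rule nn_integral_lborel_radial) measurable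
  also have "\<dots> = (\<integral>\<^sup>+s. (1 - ennreal (exp (- a * 1))) * ennreal (1 / (pi * (1 + s\<^sup>2))) \<partial>lborel)"
  proof (intro nn_integral_cong)
    fix s :: real
    \<comment> \<open>The half-line of slope \<open>s\<close> leaves the disc of squared radius
      \<open>a\<close> at the abscissa \<open>r\<close>.\<close>
    define r where "r = sqrt (a / (1 + s\<^sup>2))"
    have r: "x\<^sup>2 * (1 + s\<^sup>2) \<le> a \<longleftrightarrow> x \<le> r" if "x \<ge> 0" for x
    proof -
      have "x\<^sup>2 * (1 + s\<^sup>2) \<le> a \<longleftrightarrow> x\<^sup>2 \<le> a / (1 + s\<^sup>2)"
        using pos[of s] by (simp add: field_simps)
      also have "\<dots> \<longleftrightarrow> x \<le> r"
        using that unfolding r_def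
        by (metis real_le_rsqrt real_le_lsqrt sqrt_le_D real_sqrt_le_iff real_sqrt_abs abs_of_nonneg)
      finally show ?thesis .
    qed
    have r0: "r \<ge> 0" "r\<^sup>2 * (1 + s\<^sup>2) = a" using a pos[of s] by (auto simp: r_def)
    have "(\<integral>\<^sup>+x\<in>{0..}. ennreal x *
     (ennreal (exp (- (x\<^sup>2 * (1 + s\<^sup>2))) / pi) * indicator {..a} (x\<^sup>2 * (1 + s\<^sup>2))) \<partial>lborel) =
      (\<integral>\<^sup>+x\<in>{0..r}. ennreal (x * (exp (- (x\<^sup>2 * (1 + s\<^sup>2))) / pi)) \<partial>lborel)"
      by (auto intro!: nn_integral_cong simp: ennreal_mult[symmetric] r split: split_indicator)
    also have "\<dots> = ennreal (- exp (- (r\<^sup>2 * (1 + s\<^sup>2))) / (2 * pi * (1 + s\<^sup>2))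
      - (- exp (- (0\<^sup>2 * (1 + s\<^sup>2))) / (2 * pi * (1 + s\<^sup>2))))"
      by (rule nn_integral_FTC_Icc) (use deriv pos r0 in auto)
    also have "\<dots> = ennreal ((1 - exp (-a)) / (2 * pi * (1 + s\<^sup>2)))"
      unfolding r0 by (simp add: diff_divide_distrib)
    finally have *: "(\<integral>\<^sup>+x\<in>{0..}. ennreal x *
     (ennreal (exp (- (x\<^sup>2 * (1 + s\<^sup>2))) / pi) * indicator {..a} (x\<^sup>2 * (1 + s\<^sup>2))) \<partial>lborel) =
      ennreal ((1 - exp (-a)) / (2 * pi * (1 + s\<^sup>2)))" .
    have eq: "2 * ((1 - exp (- a)) / (2 * pi * (1 + s\<^sup>2)))
        = (1 - exp (- a)) * (1 / (pi * (1 + s\<^sup>2)))"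
      using mult_divide_mult_cancel_left[of 2 "1 - exp (- a)" "pi * (1 + s\<^sup>2)"]
      by (simp add: mult.assoc)
    have "2 * ennreal ((1 - exp (- a)) / (2 * pi * (1 + s\<^sup>2)))
        = ennreal (2 * ((1 - exp (- a)) / (2 * pi * (1 + s\<^sup>2))))"
      by (subst ennreal_mult) (use pos[of s] a in auto)
    also have "\<dots> = ennreal (1 - exp (- a)) * ennreal (1 / (pi * (1 + s\<^sup>2)))"
      unfolding eq by (rule ennreal_mult) (use pos[of s] a in auto)
    also have "ennreal (1 - exp (- a)) = 1 - ennreal (exp (- a * 1))"
      by (subst ennreal_minus[symmetric]) auto
    finally show "2 * (\<integral>\<^sup>+x\<in>{0..}. ennreal x *
     (ennreal (exp (- (x\<^sup>2 * (1 + s\<^sup>2))) / pi) * indicator {..a} (x\<^sup>2 * (1 + s\<^sup>2))) \<partial>lborel)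
      = (1 - ennreal (exp (- a * 1))) * ennreal (1 / (pi * (1 + s\<^sup>2)))"
      unfolding * .
  qed
  also have "\<dots> = (1 - ennreal (exp (- a * 1))) * K"
    unfolding K_def by (rule nn_integral_cmult) measurable
  finally show "emeasure M {x \<in> space M. (cmod (G x))\<^sup>2 \<le> a} = 1 - ennreal (exp (- a * 1))"
    by (simp add: K)
qed simp

section \<open>Jensen's formula under a Gaussian law\<close>

text \<open>Mean value property: \<open>Ln (1 + v * z)\<close> is holomorphic on the closed unit
  disc and vanishes at 0, so Cauchy's integral formula makes its mean over the unit circle 0. The
  real part of \<open>Ln\<close> is the logarithm of the modulus.\<close>

lemma has_integral_ln_cmod_circle_less:
  assumes v: "cmod v < 1"
  shows "((\<lambda>t. ln (cmod (1 + v * exp (2 * of_real pi * \<i> * of_real t)))) has_integral 0) {0..1}"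
proof -
  let ?f = "\<lambda>z. Ln (1 + v * z)"
  \<comment> \<open>A positive real part keeps \<open>1 + v * z\<close> off the branch cut of
    \<open>Ln\<close>.\<close>
  have pos: "Re (1 + v * z) > 0" if "z \<in> cball 0 1" for z
  proof -
    have "cmod (v * z) < 1"
      using v that mult_mono[of "cmod v" "cmod v" "cmod z" 1] by (simp add: norm_mult)
    then have "\<bar>Re (v * z)\<bar> < 1" using abs_Re_le_cmod[of "v * z"] by linarith
    then show ?thesis by simp
  qed
  have "((\<lambda>u. ?f u / (u - 0)) has_contour_integral (2 * of_real pi * \<i> * ?f 0)) (circlepath 0 1)"
  proof (rule Cauchy_integral_circlepath_simple)
    show "?f holomorphic_on cball 0 1"
      using pos by (intro holomorphic_intros) (force simp: complex_nonpos_Reals_iff)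
  qed simp
  then have "((\<lambda>t. ?f (exp (2 * of_real pi * \<i> * of_real t))
      * (2 * of_real pi * \<i>)) has_integral 0) {0..1}"
    unfolding has_contour_integral vector_derivative_circlepath
    by (simp add: circlepath field_simps)
  \<comment> \<open>The velocity of the circle divided by the position is the constant
    \<open>2 * of_real pi * \<i>\<close>, which remains to be cancelled.\<close>
  moreover have "z * (2 * of_real pi * \<i>) * inverse (2 * of_real pi * \<i>) = z" for z
  proof -
    have "2 * of_real pi * \<i> \<noteq> (0 :: complex)" by simp
    from right_inverse[OF this] show ?thesis by (simp only: mult.assoc[of z] mult_1_right)
  qed
  ultimately have "((\<lambda>t. ?f (exp (2 * of_real pi * \<i> * of_real t))) has_integral 0) {0..1}"
    using has_integral_mult_left[of "\<lambda>t. ?f (exp (2 * of_real pi * \<i> * of_real t))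
        * (2 * of_real pi * \<i>)"
        0 "{0..1}" "inverse (2 * of_real pi * \<i>)"] by (simp only: mult_zero_left)
  from has_integral_linear[OF this bounded_linear_Re]
  have "((\<lambda>t. Re (?f (exp (2 * of_real pi * \<i> * of_real t)))) has_integral 0) {0..1}"
    by (simp add: o_def)
  moreover have "Re (?f (exp (2 * of_real pi * \<i> * of_real t)))
      = ln (cmod (1 + v * exp (2 * of_real pi * \<i> * of_real t)))" for t :: real
  proof -
    have "Re (1 + v * exp (2 * of_real pi * \<i> * of_real t)) > 0"
      by (rule pos) (simp add: norm_exp_eq_Re)
    then have "1 + v * exp (2 * of_real pi * \<i> * of_real t) \<noteq> 0"
      by (metis less_irrefl zero_complex.sel(1))
    then show ?thesis by (rule Re_Ln)
  qed
  ultimately show ?thesis by simp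
qed

text \<open>Jensen's formula for a linear polynomial: factoring out the number of larger modulus
  leaves a factor \<open>1 + ...\<close> with vanishing mean. Equal nonzero moduli are left out
  because a zero would then lie on the circle; for \<open>w = 0\<close> the integrand is
  constant.\<close>

lemma has_integral_ln_cmod_circle:
  assumes "cmod w \<noteq> cmod v \<or> w = 0"
  shows "((\<lambda>t. ln (cmod (w + exp (2 * of_real pi * \<i> * of_real t) * v))) has_integral
           ln (max (cmod w) (cmod v))) {0..1}"
proof -
  let ?e = "\<lambda>t::real. exp (2 * of_real pi * \<i> * of_real t)"
  have e: "cmod (?e t) = 1" for t by (simp add: norm_exp_eq_Re)
  have shift: "((\<lambda>t. ln r + f t) has_integral ln r) {0..1}"
    if "(f has_integral 0) {0..1}" for f :: "real \<Rightarrow> real" and r :: real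
    using has_integral_add[OF has_integral_const_real[of "ln r" 0 1] that] by simp
  consider "v = 0" | "cmod v < cmod w" | "cmod w < cmod v" using assms by fastforce
  then show ?thesis
  proof cases
    case 1
    then show ?thesis using has_integral_const_real[of "ln (cmod w)" 0 1] by simp
  next
    case 2
    then have w: "w \<noteq> 0" and vw: "cmod (v / w) < 1" by (auto simp: norm_divide divide_less_eq)
    have "ln (cmod (w + ?e t * v)) = ln (cmod w) + ln (cmod (1 + v / w * ?e t))" for t
    proof -
      have "1 + v / w * ?e t \<noteq> 0"
      proof
        assume "1 + v / w * ?e t = 0"
        then have "v / w * ?e t = -1" by (simp add: add_eq_0_iff)
        then have "cmod (v / w * ?e t) = cmod (- 1)" by (simp only:)
        then have "cmod (v / w) = 1" unfolding norm_mult e by simp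
        with vw show False by simp
      qed
      moreover have "w + ?e t * v = w * (1 + v / w * ?e t)" using w by (simp add: field_simps)
      ultimately show ?thesis using w by (simp only: norm_mult) (simp add: ln_mult)
    qed
    with 2 shift[OF has_integral_ln_cmod_circle_less[OF vw], of "cmod w"] show ?thesis
      by (simp add: max_def)
  next
    case 3
    then have v: "v \<noteq> 0" and vw: "cmod (cnj (w / v)) < 1"
      by (auto simp: norm_divide divide_less_eq)
    \<comment> \<open>Factoring out \<open>?e t * v\<close> leaves the inverse of
      \<open>?e t\<close> next to \<open>w / v\<close>. Conjugation keeps the modulus and turns this
      inverse back into \<open>?e t\<close>, the form covered by the previous lemma.\<close>
    have "ln (cmod (w + ?e t * v)) = ln (cmod v) + ln (cmod (1 + cnj (w / v) * ?e t))" for t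
    proof -
      have "1 + cnj (w / v) * ?e t \<noteq> 0"
      proof
        assume "1 + cnj (w / v) * ?e t = 0"
        then have "cnj (w / v) * ?e t = -1" by (simp add: add_eq_0_iff)
        then have "cmod (cnj (w / v) * ?e t) = cmod (- 1)" by (simp only:)
        then have "cmod (cnj (w / v)) = 1" unfolding norm_mult e by simp
        with vw show False by simp
      qed
      moreover have "cmod (w + ?e t * v) = cmod v * cmod (1 + cnj (w / v) * ?e t)"
      proof -
        have "?e t * cnj (?e t) = 1" using e[of t] by (simp add: complex_norm_square[symmetric])
        then have "w + ?e t * v = ?e t * v * cnj (1 + cnj (w / v) * ?e t)"
          using v by (simp add: algebra_simps)
        then show ?thesis by (simp only: norm_mult e complex_mod_cnj mult_1_left)
      qed
      ultimately show ?thesis using v by (simp add: ln_mult)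
    qed
    with 3 shift[OF has_integral_ln_cmod_circle_less[OF vw], of "cmod v"] show ?thesis
      by (simp add: max_def)
  qed
qed

section \<open>Independence as a product law, and Tonelli's theorem for independent pairs\<close>

text \<open>Unlike \<open>indep_var\<close>, this allows the two variables to have different types.\<close>

definition (in prob_space) indep_pair where
  "indep_pair S X T Y \<longleftrightarrow> random_variable S X \<and> random_variable T Y \<and>
     distr M S X \<Otimes>\<^sub>M distr M T Y = distr M (S \<Otimes>\<^sub>M T) (\<lambda>x. (X x, Y x))"

lemma (in prob_space) indep_pair_compose:
  assumes "indep_pair S X T Y" and f[measurable]: "f \<in> measurable S S'"
    and g[measurable]: "g \<in> measurable T T'"
  shows "indep_pair S' (\<lambda>x. f (X x)) T' (\<lambda>x. g (Y x))"
proof -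
  from assms have X[measurable]: "random_variable S X" and Y[measurable]: "random_variable T Y"
    and eq: "distr M S X \<Otimes>\<^sub>M distr M T Y = distr M (S \<Otimes>\<^sub>M T) (\<lambda>x. (X x, Y x))"
    by (auto simp: indep_pair_def)
  interpret Y: prob_space "distr M T Y" by (rule prob_space_distr) fact
  interpret Y': prob_space "distr (distr M T Y) T' g" by (rule Y.prob_space_distr) simp
  have "distr M S' (\<lambda>x. f (X x)) \<Otimes>\<^sub>M distr M T' (\<lambda>x. g (Y x))
      = distr (distr M S X) S' f \<Otimes>\<^sub>M distr (distr M T Y) T' g"
    by (simp add: distr_distr o_def)
  also have "\<dots> = distr (distr M S X \<Otimes>\<^sub>M distr M T Y) (S' \<Otimes>\<^sub>M T') (\<lambda>(x, y). (f x, g y))"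
    by (rule pair_measure_distr) (auto intro: Y'.sigma_finite_measure_axioms)
  also have "\<dots> = distr M (S' \<Otimes>\<^sub>M T') (\<lambda>x. (f (X x), g (Y x)))"
    unfolding eq by (simp add: distr_distr o_def)
  finally show ?thesis by (simp add: indep_pair_def)
qed

text \<open>Disjoint blocks of an independent family are independent of each other. All pairs needed
  later are functions of two such blocks.\<close>

lemma (in prob_space) indep_vars_imp_indep_pair:
  assumes ind: "indep_vars M' X I" and JK: "J \<subseteq> I" "K \<subseteq> I" "J \<inter> K = {}"
  shows "indep_pair (PiM J M') (\<lambda>x. \<lambda>i\<in>J. X i x) (PiM K M') (\<lambda>x. \<lambda>i\<in>K. X i x)"
  using indep_var_restrict[OF ind JK(3,1,2)]
  by (simp add: indep_pair_def indep_var_distribution_eq)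

lemma (in prob_space) nn_integral_indep_pair:
  assumes ind: "indep_pair S X T Y"
    and f[measurable]: "(\<lambda>(x, y). f x y) \<in> borel_measurable (S \<Otimes>\<^sub>M T)"
  shows "(\<integral>\<^sup>+x. f (X x) (Y x) \<partial>M) = (\<integral>\<^sup>+x. \<integral>\<^sup>+y. f (X x) (Y y) \<partial>M \<partial>M)"
proof -
  from ind have X[measurable]: "random_variable S X" and Y[measurable]: "random_variable T Y"
    and eq: "distr M S X \<Otimes>\<^sub>M distr M T Y = distr M (S \<Otimes>\<^sub>M T) (\<lambda>x. (X x, Y x))"
    by (auto simp: indep_pair_def)
  interpret Y: prob_space "distr M T Y" by (rule prob_space_distr) fact
  have "(\<integral>\<^sup>+x. f (X x) (Y x) \<partial>M) = (\<integral>\<^sup>+z. (\<lambda>(x, y). f x y) z \<partial>distr M (S \<Otimes>\<^sub>M T) (\<lambda>x. (X x, Y x)))"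
    by (subst nn_integral_distr) auto
  also have "\<dots> = (\<integral>\<^sup>+x. \<integral>\<^sup>+y. f x y \<partial>distr M T Y \<partial>distr M S X)"
    unfolding eq[symmetric] by (subst Y.nn_integral_fst[symmetric]) auto
  also have "\<dots> = (\<integral>\<^sup>+x. \<integral>\<^sup>+y. f (X x) (Y y) \<partial>M \<partial>M)"
    by (subst nn_integral_distr) (auto intro!: nn_integral_cong simp: nn_integral_distr)
  finally show ?thesis .
qed

text \<open>A law with a density has no atoms. This rules out the equal moduli for which the circle
  mean has not been computed.\<close>

lemma (in prob_space) AE_distributed_lborel_neq:
  assumes X: "distributed M lborel X f"
  shows "AE x in M. X x \<noteq> (c :: real)"
proof -
  have [measurable]: "X \<in> borel_measurable M" "f \<in> borel_measurable borel"
    using X by (auto simp: distributed_def)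
  have "AE x in distr M lborel X. x \<noteq> c"
    unfolding distributed_distr_eq_density[OF X]
    by (subst AE_density) (use AE_lborel_singleton[of c] in auto)
  then show ?thesis by (subst (asm) AE_distr_iff) auto
qed

text \<open>By rotation invariance of \<open>G\<close> the integrand may be averaged over a circle, where Jensen's
  formula applies. Subtracting from \<open>ln ((\<bar>A\<bar> + \<bar>B G\<bar>)\<^sup>2)\<close> makes it nonnegative, so that Tonelli
  needs no integrability assumption; the value \<open>\<infinity>\<close> at the zeros of \<open>A + B G\<close> yields that these
  form a null set.\<close>

lemma (in prob_space) ln_cmod_add_gaussian:
  assumes ind: "indep_pair borel (\<lambda>x. (A x, B x)) borel G" and G: "cs_complex_gaussian M 1 G"
  assumes A0: "AE x in M. A x \<noteq> 0 \<or> B x * G x \<noteq> 0"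
  assumes int: "integrable M (\<lambda>x. ln (max ((cmod (A x))\<^sup>2) ((cmod (B x * G x))\<^sup>2)))"
    (is "integrable M ?m")
  shows "integrable M (\<lambda>x. ln ((cmod (A x + B x * G x))\<^sup>2))"
    and "expectation (\<lambda>x. ln ((cmod (A x + B x * G x))\<^sup>2)) = expectation ?m"
    and "AE x in M. A x + B x * G x \<noteq> 0"
proof -
  have ABm: "(\<lambda>x. (A x, B x)) \<in> borel_measurable M" and Gm[measurable]: "G \<in> borel_measurable M"
    using ind by (auto simp: indep_pair_def)
  have Am[measurable]: "A \<in> borel_measurable M" and Bm[measurable]: "B \<in> borel_measurable M"
    using ABm by (auto simp: borel_prod[symmetric] dest: measurable_compose[OF _ measurable_fst] measurable_compose[OF _ measurable_snd])
  define D :: "complex \<Rightarrow> complex \<Rightarrow> real"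
    where "D = (\<lambda>w v. ln ((cmod w + cmod v)\<^sup>2) - ln ((cmod (w + v))\<^sup>2))"
  \<comment> \<open>\<open>D\<close> misses the singularity at \<open>w + v = 0\<close> because
    \<open>ln 0 = 0\<close>; \<open>D'\<close> puts the value \<infinity> there. At
    \<open>w = v = 0\<close> both logarithms in \<open>D\<close> take the default value 0 and
    \<open>D'\<close> stays 0, in agreement with \<open>h\<close>.\<close>
  define D' :: "complex \<Rightarrow> complex \<Rightarrow> ennreal"
    where "D' = (\<lambda>w v. if w + v = 0 \<and> w \<noteq> 0 then \<top> else ennreal (D w v))"
  define h :: "complex \<Rightarrow> complex \<Rightarrow> real"
    where "h = (\<lambda>w v. ln ((cmod w + cmod v)\<^sup>2) - ln (max ((cmod w)\<^sup>2) ((cmod v)\<^sup>2)))"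
  define e where "e = (\<lambda>t::real. exp (2 * of_real pi * \<i> * of_real t))"
  have [measurable]: "(\<lambda>(w, v). D w v) \<in> borel_measurable (borel \<Otimes>\<^sub>M borel)"
     "(\<lambda>(w, v). h w v) \<in> borel_measurable (borel \<Otimes>\<^sub>M borel)"
    unfolding D_def h_def by measurable
  have [measurable]: "(\<lambda>(w, v). D' w v) \<in> borel_measurable (borel \<Otimes>\<^sub>M borel)"
    unfolding D'_def by measurable
  have [measurable]: "e \<in> borel_measurable borel"
    unfolding e_def by (intro borel_measurable_continuous_onI continuous_intros)
  have e: "cmod (e t) = 1" for t by (simp add: e_def norm_exp_eq_Re)
  have D0: "0 \<le> D w v" if "w + v \<noteq> 0 \<or> w = 0" for w v
  proof (cases "w + v = 0")
    case False
    then have "(cmod (w + v))\<^sup>2 \<le> (cmod w + cmod v)\<^sup>2" and "0 < (cmod (w + v))\<^sup>2"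
      by (auto intro!: power_mono norm_triangle_ineq)
    then have "ln ((cmod (w + v))\<^sup>2) \<le> ln ((cmod w + cmod v)\<^sup>2)"
      by (subst ln_le_cancel_iff) auto
    then show ?thesis unfolding D_def by simp
  qed (use that in \<open>auto simp: D_def\<close>)
  \<comment> \<open>The square of a sum of two nonnegative numbers lies between the larger of their
    squares and four times it. Boundedness makes the mean of \<open>h\<close> finite, whatever the
    laws of \<open>A\<close> and \<open>B\<close>.\<close>
  have h0: "0 \<le> h w v" and h1: "h w v \<le> ln 4" for w v
  proof -
    let ?mx = "max ((cmod w)\<^sup>2) ((cmod v)\<^sup>2)"
    have "0 \<le> h w v \<and> h w v \<le> ln 4"
    proof (cases "w = 0 \<and> v = 0")
      case False
      then have m: "0 < ?mx" and s: "cmod w + cmod v \<noteq> 0"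
        by (auto simp: less_max_iff_disj add_nonneg_eq_0_iff)
      have "(cmod w)\<^sup>2 \<le> (cmod w + cmod v)\<^sup>2" "(cmod v)\<^sup>2 \<le> (cmod w + cmod v)\<^sup>2"
        by (auto intro!: power_mono)
      then have m1: "?mx \<le> (cmod w + cmod v)\<^sup>2" by simp
      have "(cmod w + cmod v)\<^sup>2 \<le> 2 * (cmod w)\<^sup>2 + 2 * (cmod v)\<^sup>2"
        using zero_le_power2[of "cmod w - cmod v"] by (simp add: power2_sum power2_diff)
      also have "\<dots> \<le> 4 * ?mx" by simp
      finally have m2: "(cmod w + cmod v)\<^sup>2 \<le> 4 * ?mx" .
      have "ln ?mx \<le> ln ((cmod w + cmod v)\<^sup>2)" using m m1 s by (subst ln_le_cancel_iff) auto
      moreover have "ln ((cmod w + cmod v)\<^sup>2) \<le> ln (4 * ?mx)" using m m1 m2 s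
        by (subst ln_le_cancel_iff) auto
      moreover have "ln (4 * ?mx) = ln 4 + ln ?mx" using m by (subst ln_mult) auto
      ultimately show ?thesis by (simp add: h_def)
    qed (auto simp: h_def)
    then show "0 \<le> h w v" "h w v \<le> ln 4" by auto
  qed
  have circ: "(\<integral>\<^sup>+t. D' w (e t * v) * indicator {0..1} t \<partial>lborel) = ennreal (h w v)"
    if wv: "cmod w \<noteq> cmod v \<or> w = 0" for w v
  proof -
    have nz: "w + e t * v \<noteq> 0 \<or> w = 0" for t
    proof (rule ccontr)
      assume "\<not> ?thesis"
      then have "w \<noteq> 0" "w = - (e t * v)" by (auto simp: add_eq_0_iff2)
      then have "cmod w = cmod v" by (simp add: norm_mult e)
      with \<open>w \<noteq> 0\<close> wv show False by simp
    qed
    have lnsq: "ln (x\<^sup>2) = 2 * ln x" if "x \<ge> 0" for x :: real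
      using that by (cases "x = 0") (auto simp: ln_realpow)
    have mx: "max ((cmod w)\<^sup>2) ((cmod v)\<^sup>2) = (max (cmod w) (cmod v))\<^sup>2"
      by (auto simp: max_def)
    have "((\<lambda>t. D w (e t * v)) has_integral (ln ((cmod w + cmod v)\<^sup>2) - 2
        * ln (max (cmod w) (cmod v)))) {0..1}"
      using has_integral_diff[OF has_integral_const_real[of "ln ((cmod w + cmod v)\<^sup>2)" 0 1]
        has_integral_mult_right[OF has_integral_ln_cmod_circle[OF wv], of 2]]
      unfolding D_def by (simp add: norm_mult e) (simp add: lnsq e_def)
    then have "((\<lambda>t. D w (e t * v)) has_integral h w v) {0..1}"
      by (simp add: h_def mx lnsq le_max_iff_disj)
    from nn_integral_has_integral_lebesgue[OF _ this]
    have "(\<integral>\<^sup>+t. ennreal (indicator {0..1} t * D w (e t * v)) \<partial>lborel) = ennreal (h w v)"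
      using D0 nz by blast
    also have "(\<integral>\<^sup>+t. ennreal (indicator {0..1} t * D w (e t * v)) \<partial>lborel) =
        (\<integral>\<^sup>+t. D' w (e t * v) * indicator {0..1} t \<partial>lborel)"
      using nz by (auto intro!: nn_integral_cong simp: D'_def split: split_indicator)
    finally show ?thesis .
  qed
  have pms: "pair_sigma_finite M (lborel :: real measure)"
    by (intro pair_sigma_finite.intro sigma_finite_measure_axioms sigma_finite_lborel)
  have inner: "(\<integral>\<^sup>+y. D' a (b * G y) \<partial>M) = (\<integral>\<^sup>+y. ennreal (h a (b * G y)) \<partial>M)" for a b
  proof -
    \<comment> \<open>Averaging over the circle: the integral is multiplied by the length 1 of
      \<open>{0..1}\<close>, \<open>G\<close> is rotated by \<open>e t\<close> separately for each
      \<open>t\<close>, and Tonelli brings the mean over \<open>t\<close> inside.\<close>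
    have "(\<integral>\<^sup>+y. D' a (b * G y) \<partial>M)
        = (\<integral>\<^sup>+t. (\<integral>\<^sup>+y. D' a (b * G y) \<partial>M) * indicator {0..1::real} t \<partial>lborel)"
      by (subst nn_integral_cmult) auto
    also have "\<dots> = (\<integral>\<^sup>+t. (\<integral>\<^sup>+y. D' a (b * (e t * G y)) * indicator {0..1::real} t \<partial>M) \<partial>lborel)"
      using nn_integral_cs_complex_gaussian_rotate[OF G _ e, of "\<lambda>z. D' a (b * z)"]
      by (intro nn_integral_cong) (simp add: nn_integral_multc)
    also have "\<dots> = (\<integral>\<^sup>+y. (\<integral>\<^sup>+t. D' a (e t * (b * G y)) * indicator {0..1::real} t \<partial>lborel) \<partial>M)"
      by (subst pair_sigma_finite.Fubini'[OF pms]) (simp_all add: mult.left_commute)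
    also have "\<dots> = (\<integral>\<^sup>+y. ennreal (h a (b * G y)) \<partial>M)"
    proof (rule nn_integral_cong_AE)
      show "AE y in M. (\<integral>\<^sup>+t. D' a (e t * (b * G y)) * indicator {0..1::real} t \<partial>lborel)
          = ennreal (h a (b * G y))"
        \<comment> \<open>For fixed \<open>a\<close> and \<open>b \<noteq> 0\<close>, equality of
          the two moduli pins the squared modulus of \<open>G\<close> to a single value.\<close>
        using AE_distributed_lborel_neq[OF cs_complex_gaussian_exponential[OF G],
        of "(cmod a / cmod b)\<^sup>2"]
      proof eventually_elim
        case (elim y)
        then have "cmod a \<noteq> cmod (b * G y) \<or> a = 0"
          by (cases "b = 0") (auto simp: norm_mult)
        then show ?case by (rule circ)
      qed
    qed
    finally show ?thesis .
  qed
  have iv: "(\<integral>\<^sup>+x. f (A x) (B x * G x) \<partial>M) = (\<integral>\<^sup>+x. \<integral>\<^sup>+y. f (A x) (B x * G y) \<partial>M \<partial>M)"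
    if [measurable]: "(\<lambda>(w, v). f w v) \<in> borel_measurable (borel \<Otimes>\<^sub>M borel)" for f :: "complex \<Rightarrow> complex \<Rightarrow> ennreal"
  proof -
    have [measurable]: "(\<lambda>(x, y). f (fst x) (snd x * y)) \<in> borel_measurable (borel \<Otimes>\<^sub>M borel)"
      unfolding borel_prod[symmetric] by measurable
    show ?thesis
      using nn_integral_indep_pair[OF ind, of "\<lambda>ab g. f (fst ab) (snd ab * g)"] by simp
  qed
  have nn: "(\<integral>\<^sup>+x. D' (A x) (B x * G x) \<partial>M) = (\<integral>\<^sup>+x. ennreal (h (A x) (B x * G x)) \<partial>M)"
    by (subst (1 2) iv) (simp_all add: inner)
  have hint: "integrable M (\<lambda>x. h (A x) (B x * G x))"
    by (rule integrable_const_bound[where B="ln 4"]) (auto simp: h0 h1 abs_of_nonneg)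
  have nnh: "(\<integral>\<^sup>+x. ennreal (h (A x) (B x * G x)) \<partial>M)
      = ennreal (expectation (\<lambda>x. h (A x) (B x * G x)))"
    by (rule nn_integral_eq_integral[OF hint]) (simp add: h0)
  \<comment> \<open>The integral of \<open>D'\<close> equals that of the bounded function
    \<open>h\<close>, so the value \<infinity> occurs on a null set only. This excludes zeros with
    \<open>A x \<noteq> 0\<close>; those with \<open>A x = 0\<close> are excluded by
    \<open>A0\<close>.\<close>
  have "AE x in M. D' (A x) (B x * G x) \<noteq> \<infinity>"
    by (rule nn_integral_PInf_AE) (auto simp: nn nnh)
  then have ae: "AE x in M. A x + B x * G x \<noteq> 0 \<or> A x = 0"
    by eventually_elim (auto simp: D'_def split: if_splits)
  with A0 show "AE x in M. A x + B x * G x \<noteq> 0" by eventually_elim auto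
  have "(\<integral>\<^sup>+x. ennreal (D (A x) (B x * G x)) \<partial>M) = (\<integral>\<^sup>+x. D' (A x) (B x * G x) \<partial>M)"
    by (rule nn_integral_cong_AE, use ae in eventually_elim) (auto simp: D'_def)
  also note nn also note nnh
  finally have "integrable M (\<lambda>x. D (A x) (B x * G x)) \<and>
      expectation (\<lambda>x. D (A x) (B x * G x)) = expectation (\<lambda>x. h (A x) (B x * G x))"
    using ae by (subst (asm) nn_integral_eq_integrable) (auto simp: h0 D0 elim!: eventually_mono)
  \<comment> \<open>In this decomposition \<open>h\<close> and \<open>D\<close> have the same finite
    expectation, so only \<open>?m\<close> survives.\<close>
  moreover have eq: "ln ((cmod (A x + B x * G x))\<^sup>2)
      = h (A x) (B x * G x) + ?m x - D (A x) (B x * G x)" for x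
    by (simp add: h_def D_def)
  ultimately show "integrable M (\<lambda>x. ln ((cmod (A x + B x * G x))\<^sup>2))"
    and "expectation (\<lambda>x. ln ((cmod (A x + B x * G x))\<^sup>2)) = expectation ?m"
    unfolding eq using hint int by auto
qed

section \<open>Exponential variables and special functions\<close>

text \<open>On \<open>{c..}\<close> the factor \<open>1 / t\<close> is at most \<open>1 / c\<close>,
  so the integral is finite. Finiteness ensures that the Lebesgue integral defining
  \<open>exp_integral_E1\<close> is the true value and not the default 0.\<close>

lemma nn_integral_exp_integral_E1:
  assumes c: "c > 0"
  shows "(\<integral>\<^sup>+t\<in>{c..}. ennreal (exp (- t) / t) \<partial>lborel) = ennreal (exp_integral_E1 c)"
    and "exp_integral_E1 c \<ge> 0"
proof -
  have "(\<integral>\<^sup>+t\<in>{c..}. ennreal (exp (- t) / t) \<partial>lborel)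
      \<le> (\<integral>\<^sup>+t\<in>{c..}. ennreal (exp (- t) / c) \<partial>lborel)"
    using c by (intro nn_integral_mono) (auto split: split_indicator simp: field_simps intro!: ennreal_leI)
  also have "\<dots> = ennreal (0 - (- exp (- c) / c))"
  proof (rule nn_integral_FTC_atLeast[where F="\<lambda>t. - exp (- t) / c"])
    show "((\<lambda>t. - exp (- t) / c) \<longlongrightarrow> 0) at_top" using c by real_asymp
  qed (use c in \<open>auto intro!: derivative_eq_intros\<close>)
  finally have fin: "(\<integral>\<^sup>+t\<in>{c..}. ennreal (exp (- t) / t) \<partial>lborel) < \<infinity>"
    by (auto simp: less_top[symmetric] top_unique)
  have eq: "(\<integral>\<^sup>+t\<in>{c..}. ennreal (exp (- t) / t) \<partial>lborel)
      = (\<integral>\<^sup>+t. ennreal (indicator {c..} t * (exp (- t) / t)) \<partial>lborel)"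
    by (auto intro!: nn_integral_cong split: split_indicator)
  have pos: "AE t in lborel. 0 \<le> indicator {c..} t * (exp (- t) / t)"
    using c by (auto split: split_indicator)
  have "integrable lborel (\<lambda>t. indicator {c..} t * (exp (- t) / t))"
    by (rule integrableI_nonneg[OF _ pos]) (use fin eq in auto)
  from nn_integral_eq_integral[OF this pos]
  show "(\<integral>\<^sup>+t\<in>{c..}. ennreal (exp (- t) / t) \<partial>lborel) = ennreal (exp_integral_E1 c)"
    unfolding eq by (simp add: exp_integral_E1_def set_lebesgue_integral_def)
  show "exp_integral_E1 c \<ge> 0"
    unfolding exp_integral_E1_def set_lebesgue_integral_def
    by (rule integral_nonneg_AE) (use pos in simp)
qed

text \<open>Layer-cake form of the positive part of \<open>ln (w / c)\<close>.\<close>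

lemma ennreal_ln_max_layer_cake:
  assumes "c > 0" "w \<ge> 0"
  shows "ennreal (ln (max 1 (w / c))) = (\<integral>\<^sup>+t\<in>{c..}. ennreal (1 / t) * indicator {..w} t \<partial>lborel)"
proof (cases "c \<le> w")
  case True
  have "(\<integral>\<^sup>+t\<in>{c..}. ennreal (1 / t) * indicator {..w} t \<partial>lborel)
      = (\<integral>\<^sup>+t\<in>{c..w}. ennreal (1 / t) \<partial>lborel)"
    by (auto intro!: nn_integral_cong split: split_indicator)
  also have "\<dots> = ennreal (ln w - ln c)"
    by (rule nn_integral_FTC_Icc) (use assms True in \<open>auto intro!: derivative_eq_intros\<close>)
  also have "ln w - ln c = ln (max 1 (w / c))"
    using assms True by (simp add: ln_div max_def)
  finally show ?thesis ..
next
  case False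
  have "(\<integral>\<^sup>+t\<in>{c..}. ennreal (1 / t) * indicator {..w} t \<partial>lborel)
      = (\<integral>\<^sup>+t. 0 \<partial>(lborel :: real measure))"
    using False by (intro nn_integral_cong) (auto split: split_indicator)
  with False assms show ?thesis by (simp add: max_def)
qed

lemma (in prob_space) nn_integral_exponential:
  assumes X: "distributed M lborel X (\<lambda>x. ennreal (exponential_density 1 x))"
    and [measurable]: "f \<in> borel_measurable borel"
  shows "(\<integral>\<^sup>+x. f (X x) \<partial>M) = (\<integral>\<^sup>+t\<in>{0..}. ennreal (exp (- t)) * f t \<partial>lborel)"
proof -
  have "(\<integral>\<^sup>+x. f (X x) \<partial>M) = (\<integral>\<^sup>+t. ennreal (exponential_density 1 t) * f t \<partial>lborel)"
    by (rule distributed_nn_integral[OF X, symmetric]) simp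
  also have "\<dots> = (\<integral>\<^sup>+t\<in>{0..}. ennreal (exp (- t)) * f t \<partial>lborel)"
    by (intro nn_integral_cong) (auto simp: exponential_density_def split: split_indicator)
  finally show ?thesis .
qed

lemma nn_integral_exp_decay:
  assumes q: "q > 0"
  shows "(\<integral>\<^sup>+s\<in>{0..}. ennreal (exp (- q * s)) \<partial>lborel) = ennreal (1 / q)"
proof -
  have "(\<integral>\<^sup>+s\<in>{0..}. ennreal (exp (- q * s)) \<partial>lborel) = ennreal (0 - (- exp (- q * 0) / q))"
  proof (rule nn_integral_FTC_atLeast[where F="\<lambda>s. - exp (- q * s) / q"])
    show "((\<lambda>s. - exp (- q * s) / q) \<longlongrightarrow> 0) at_top" using q by real_asymp
  qed (use q in \<open>auto intro!: derivative_eq_intros\<close>)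
  then show ?thesis by simp
qed

lemma (in prob_space) AE_exponential_pos:
  assumes X: "distributed M lborel X (\<lambda>x. ennreal (exponential_density 1 x))"
  shows "AE x in M. X x > 0"
proof -
  have [measurable]: "X \<in> borel_measurable M" using X by (auto simp: distributed_def)
  have "AE x in distr M lborel X. x > 0"
    unfolding distributed_distr_eq_density[OF X]
    by (subst AE_density) (use AE_lborel_singleton[of "0::real"] in
      \<open>auto simp: exponential_density_def elim!: eventually_mono split: if_splits\<close>)
  then show ?thesis by (subst (asm) AE_distr_iff) auto
qed

lemma (in prob_space) exponential_tail:
  assumes X: "distributed M lborel X (\<lambda>x. ennreal (exponential_density 1 x))" and t: "t \<ge> 0"
  shows "(\<integral>\<^sup>+x. indicator {t..} (X x) \<partial>M) = ennreal (exp (- t))"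
proof -
  have "(\<integral>\<^sup>+x. indicator {t..} (X x) \<partial>M)
      = (\<integral>\<^sup>+s\<in>{0..}. ennreal (exp (- s)) * indicator {t..} s \<partial>lborel)"
    by (rule nn_integral_exponential[OF X]) simp
  also have "\<dots> = (\<integral>\<^sup>+s\<in>{t..}. ennreal (exp (- s)) \<partial>lborel)"
    using t by (intro nn_integral_cong) (auto split: split_indicator)
  also have "\<dots> = ennreal (0 - (- exp (- t)))"
  proof (rule nn_integral_FTC_atLeast)
    show "((\<lambda>t::real. - exp (- t)) \<longlongrightarrow> 0) at_top" by real_asymp
  qed (auto intro!: derivative_eq_intros)
  finally show ?thesis by simp
qed

text \<open>In the layer-cake form the lower limit \<open>c\<close> absorbs the scaling, and the
  tail \<open>exp (- t)\<close> weighted by \<open>1 / t\<close> is the integrand of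
  \<open>exp_integral_E1\<close>.\<close>

lemma (in prob_space) nn_integral_ln_max_exponential:
  assumes X: "distributed M lborel X (\<lambda>x. ennreal (exponential_density 1 x))" and c: "c > 0"
  shows "(\<integral>\<^sup>+x. ennreal (ln (max 1 (X x / c))) \<partial>M) = ennreal (exp_integral_E1 c)"
proof -
  have [measurable]: "X \<in> borel_measurable M" using X by (auto simp: distributed_def)
  have pms: "pair_sigma_finite M (lborel :: real measure)"
    by (intro pair_sigma_finite.intro sigma_finite_measure_axioms sigma_finite_lborel)
  have "(\<integral>\<^sup>+x. ennreal (ln (max 1 (X x / c))) \<partial>M)
      = (\<integral>\<^sup>+x. \<integral>\<^sup>+t. ennreal (1 / t) * indicator {c..} t * indicator {t..} (X x) \<partial>lborel \<partial>M)"
  proof (rule nn_integral_cong_AE, use AE_exponential_pos[OF X] in eventually_elim)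
    fix x assume "0 < X x"
    then have "ennreal (ln (max 1 (X x / c)))
        = (\<integral>\<^sup>+t\<in>{c..}. ennreal (1 / t) * indicator {..X x} t \<partial>lborel)"
      using c by (intro ennreal_ln_max_layer_cake) auto
    also have "\<dots> = (\<integral>\<^sup>+t. ennreal (1 / t) * indicator {c..} t * indicator {t..} (X x) \<partial>lborel)"
      by (intro nn_integral_cong) (auto split: split_indicator)
    finally show "ennreal (ln (max 1 (X x / c))) = \<dots>" .
  qed
  also have "\<dots> = (\<integral>\<^sup>+t. \<integral>\<^sup>+x. ennreal (1 / t) * indicator {c..} t
      * indicator {t..} (X x) \<partial>M \<partial>lborel)"
    by (rule pair_sigma_finite.Fubini'[OF pms, symmetric]) (simp add: indicator_def atLeast_def)
  also have "\<dots> = (\<integral>\<^sup>+t\<in>{c..}. ennreal (exp (- t) / t) \<partial>lborel)"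
  proof (rule nn_integral_cong)
    fix t :: real
    have "(\<integral>\<^sup>+x. ennreal (1 / t) * indicator {c..} t * indicator {t..} (X x) \<partial>M)
        = ennreal (1 / t) * indicator {c..} t * (\<integral>\<^sup>+x. indicator {t..} (X x) \<partial>M)"
      by (rule nn_integral_cmult) measurable
    also have "\<dots> = ennreal (exp (- t) / t) * indicator {c..} t"
      using c by (auto simp: exponential_tail[OF X] ennreal_mult[symmetric] split: split_indicator)
    finally show "(\<integral>\<^sup>+x. ennreal (1 / t) * indicator {c..} t * indicator {t..} (X x) \<partial>M) = \<dots>" .
  qed
  finally show ?thesis by (simp add: nn_integral_exp_integral_E1[OF c])
qed

text \<open>The substitution \<open>t = sqrt c * exp u\<close> turns \<open>t + c / t\<close> into \<open>2 * sqrt c * cosh u\<close>.\<close>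

lemma nn_integral_bessel_K_0:
  assumes c: "c > 0"
  shows "(\<integral>\<^sup>+t\<in>{0<..}. ennreal (exp (- t - c / t) / t) \<partial>lborel)
      = ennreal (2 * bessel_K 0 (2 * sqrt c))"
    and "bessel_K 0 (2 * sqrt c) \<ge> 0"
proof -
  define F where "F = (\<lambda>t::real. exp (- t - c / t) / t)"
  define g where "g = (\<lambda>u::real. sqrt c * exp u)"
  define H where "H = (\<lambda>u::real. exp (- (2 * sqrt c) * cosh u))"
  have [measurable]: "F \<in> borel_measurable borel" "H \<in> borel_measurable borel"
    unfolding F_def H_def cosh_def by measurable
  have F0: "0 \<le> F t" if "t > 0" for t using that by (simp add: F_def)
  \<comment> \<open>Near 0 the factor \<open>exp (- (c / t))\<close> beats \<open>1 / t\<close>; the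
    bound \<open>c / t \<le> exp (c / t)\<close> makes this quantitative.\<close>
  have Fle: "F t \<le> exp (- t) / c" if t: "t > 0" for t
  proof -
    have "c / t \<le> exp (c / t)" using exp_ge_add_one_self[of "c / t"] by linarith
    then have "exp (- (c / t)) / t \<le> 1 / c" using t c by (simp add: exp_minus field_simps)
    then have "exp (- t) * (exp (- (c / t)) / t) \<le> exp (- t) * (1 / c)"
      by (rule mult_left_mono) simp
    then show ?thesis by (simp add: F_def exp_diff exp_minus field_simps)
  qed
  have "integrable lborel (\<lambda>t. indicator {0<..} t *\<^sub>R F t)"
  proof (rule integrableI_nonneg)
    show "AE t in lborel. 0 \<le> indicator {0<..} t *\<^sub>R F t" using F0
      by (auto split: split_indicator)
    have "(\<integral>\<^sup>+t. ennreal (indicator {0<..} t *\<^sub>R F t) \<partial>lborel)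
        \<le> (\<integral>\<^sup>+t\<in>{0..}. ennreal (exp (- t) / c) \<partial>lborel)"
      using Fle by (intro nn_integral_mono) (auto split: split_indicator intro!: ennreal_leI)
    also have "\<dots> = ennreal (0 - (- exp (- 0) / c))"
    proof (rule nn_integral_FTC_atLeast)
      show "((\<lambda>t. - exp (- t) / c) \<longlongrightarrow> 0) at_top" using c by real_asymp
    qed (use c in \<open>auto intro!: derivative_eq_intros\<close>)
    finally show "(\<integral>\<^sup>+t. ennreal (indicator {0<..} t *\<^sub>R F t) \<partial>lborel) < \<infinity>"
      by (auto simp: less_top[symmetric] top_unique)
  qed measurable
  then have Fabs: "F absolutely_integrable_on {0<..}"
    unfolding set_integrable_def by (subst integrable_completion) auto
  have range: "range g = {0<..}"
  proof (intro equalityI subsetI)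
    fix t :: real assume "t \<in> {0<..}"
    then have "t = g (ln (t / sqrt c))" using c by (simp add: g_def)
    then show "t \<in> range g" by blast
  qed (use c in \<open>auto simp: g_def\<close>)
  have "(\<lambda>u. \<bar>sqrt c * exp u\<bar> * F (g u)) absolutely_integrable_on UNIV \<and>
      integral UNIV (\<lambda>u. \<bar>sqrt c * exp u\<bar> * F (g u)) = integral {0<..} F"
  proof (rule iffD2[OF has_absolute_integral_change_of_variables_1'[where g=g and f=F
    and S=UNIV]])
    show "(g has_field_derivative sqrt c * exp x) (at x)" for x
      unfolding g_def by (auto intro!: derivative_eq_intros)
    show "inj g" using c by (auto simp: inj_on_def g_def)
  qed (use Fabs range in auto)
  \<comment> \<open>The derivative of \<open>g\<close> is \<open>g\<close> itself, which cancels the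
    factor \<open>1 / t\<close> of \<open>F\<close>.\<close>
  moreover have "\<bar>sqrt c * exp u\<bar> * F (g u) = H u" for u
  proof -
    have "c / g u = sqrt c * exp (- u)"
      using c by (simp add: g_def exp_minus field_simps real_sqrt_mult_self)
    then show ?thesis using c
      by (simp add: F_def H_def cosh_def) (simp add: g_def algebra_simps)
  qed
  ultimately have "(H has_integral integral {0<..} F) UNIV"
    by (simp add: has_integral_iff absolutely_integrable_on_def)
  from nn_integral_has_integral_lborel[OF _ _ this]
  have nnH: "(\<integral>\<^sup>+u. ennreal (H u) \<partial>lborel) = ennreal (integral {0<..} F)"
    using \<open>H \<in> borel_measurable borel\<close> by (auto simp: H_def)
  have "(F has_integral integral {0<..} F) {0<..}"
    using Fabs by (simp add: has_integral_iff absolutely_integrable_on_def)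
  from nn_integral_has_integral_lebesgue[OF _ this]
  have "(\<integral>\<^sup>+t. ennreal (indicator {0<..} t * F t) \<partial>lborel) = ennreal (integral {0<..} F)"
    using F0 by auto
  also have "(\<integral>\<^sup>+t. ennreal (indicator {0<..} t * F t) \<partial>lborel)
      = (\<integral>\<^sup>+t\<in>{0<..}. ennreal (F t) \<partial>lborel)"
    by (intro nn_integral_cong) (auto split: split_indicator)
  finally have nnF: "(\<integral>\<^sup>+t\<in>{0<..}. ennreal (F t) \<partial>lborel) = (\<integral>\<^sup>+u. ennreal (H u) \<partial>lborel)"
    using nnH by simp
  \<comment> \<open>The substitution runs over the whole line while \<open>bessel_K\<close>
    integrates over \<open>{0..}\<close>: this is the origin of the factor 2.\<close>
  have even: "(\<integral>\<^sup>+u. ennreal (H u) \<partial>lborel) = 2 * (\<integral>\<^sup>+u\<in>{0..}. ennreal (H u) \<partial>lborel)"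
    by (rule nn_integral_lborel_even) (measurable, simp add: H_def)
  have eq: "(\<integral>\<^sup>+u\<in>{0..}. ennreal (H u) \<partial>lborel)
      = (\<integral>\<^sup>+u. ennreal (indicator {0..} u *\<^sub>R H u) \<partial>lborel)"
    by (intro nn_integral_cong) (auto split: split_indicator)
  have fin: "(\<integral>\<^sup>+u\<in>{0..}. ennreal (H u) \<partial>lborel) \<noteq> \<infinity>"
  proof
    assume "(\<integral>\<^sup>+u\<in>{0..}. ennreal (H u) \<partial>lborel) = \<infinity>"
    then show False using even nnH by (simp add: ennreal_mult_top)
  qed
  have pos: "AE u in lborel. 0 \<le> indicator {0..} u *\<^sub>R H u"
    by (auto simp: H_def split: split_indicator)
  have "integrable lborel (\<lambda>u. indicator {0..} u *\<^sub>R H u)"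
    by (rule integrableI_nonneg[OF _ pos]) (use fin eq in \<open>auto simp: less_top\<close>)
  from nn_integral_eq_integral[OF this pos]
  have K: "(\<integral>\<^sup>+u\<in>{0..}. ennreal (H u) \<partial>lborel) = ennreal (bessel_K 0 (2 * sqrt c))"
    unfolding eq by (simp add: bessel_K_def set_lebesgue_integral_def H_def)
  show b: "bessel_K 0 (2 * sqrt c) \<ge> 0"
    unfolding bessel_K_def set_lebesgue_integral_def by (rule integral_nonneg_AE) auto
  show "(\<integral>\<^sup>+t\<in>{0<..}. ennreal (exp (- t - c / t) / t) \<partial>lborel)
      = ennreal (2 * bessel_K 0 (2 * sqrt c))"
    using nnF[unfolded even K] b by (simp add: F_def ennreal_mult)
qed

text \<open>For fixed \<open>X\<close> the mean over \<open>Y\<close> is an \<open>E\<^sub>1\<close>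
  integral with lower limit \<open>c / X\<close>. Swapping this integral with the one over the law
  of \<open>X\<close> integrates \<open>exp (- s)\<close> over \<open>s \<ge> c / t\<close>, which
  yields the factor \<open>exp (- (c / t))\<close> of the Bessel integrand.\<close>

lemma (in prob_space) nn_integral_ln_max_exponential_product:
  assumes X: "distributed M lborel X (\<lambda>x. ennreal (exponential_density 1 x))"
    and Y: "distributed M lborel Y (\<lambda>x. ennreal (exponential_density 1 x))"
    and XY: "indep_pair borel X borel Y" and c: "c > 0"
  shows "(\<integral>\<^sup>+x. ennreal (ln (max 1 (X x * Y x / c))) \<partial>M) = ennreal (2 * bessel_K 0 (2 * sqrt c))"
proof -
  have [measurable]: "X \<in> borel_measurable M" using X by (auto simp: distributed_def)
  define E where "E = (\<lambda>c. \<integral>\<^sup>+t\<in>{c..}. ennreal (exp (- t) / t) \<partial>lborel)"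
  have [measurable]: "E \<in> borel_measurable borel"
    unfolding E_def indicator_def atLeast_def by measurable
  have "(\<integral>\<^sup>+x. ennreal (ln (max 1 (X x * Y x / c))) \<partial>M) =
     (\<integral>\<^sup>+x. \<integral>\<^sup>+y. ennreal (ln (max 1 (X x * Y y / c))) \<partial>M \<partial>M)"
    by (rule nn_integral_indep_pair[OF XY]) measurable
  also have "\<dots> = (\<integral>\<^sup>+x. E (c / X x) \<partial>M)"
  proof (rule nn_integral_cong_AE, use AE_exponential_pos[OF X] in eventually_elim)
    fix x assume "0 < X x"
    then show "(\<integral>\<^sup>+y. ennreal (ln (max 1 (X x * Y y / c))) \<partial>M) = E (c / X x)"
      using nn_integral_ln_max_exponential[OF Y, of "c / X x"] c
      by (simp add: nn_integral_exp_integral_E1 mult.commute E_def)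
  qed
  also have "\<dots> = (\<integral>\<^sup>+s\<in>{0..}. ennreal (exp (- s)) * E (c / s) \<partial>lborel)"
    by (rule nn_integral_exponential[OF X]) measurable
  also have "\<dots> = (\<integral>\<^sup>+s. \<integral>\<^sup>+t. ennreal (exp (- s)) * indicator {0<..} s
      * (ennreal (exp (- t) / t) * indicator {c / s..} t) \<partial>lborel \<partial>lborel)"
    by (rule nn_integral_cong_AE, use AE_lborel_singleton[of "0::real"] in eventually_elim)
       (auto simp: E_def nn_integral_cmult split: split_indicator)
  also have "\<dots> = (\<integral>\<^sup>+t. \<integral>\<^sup>+s. ennreal (exp (- s)) * indicator {0<..} s
      * (ennreal (exp (- t) / t) * indicator {c / s..} t) \<partial>lborel \<partial>lborel)"
    by (rule lborel_pair.Fubini'[symmetric]) (simp add: indicator_def atLeast_def)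
  also have "\<dots> = (\<integral>\<^sup>+t\<in>{0<..}. ennreal (exp (- t - c / t) / t) \<partial>lborel)"
  proof (rule nn_integral_cong)
    fix t :: real
    show "(\<integral>\<^sup>+s. ennreal (exp (- s)) * indicator {0<..} s
        * (ennreal (exp (- t) / t) * indicator {c / s..} t) \<partial>lborel)
      = ennreal (exp (- t - c / t) / t) * indicator {0<..} t"
    proof (cases "t > 0")
      case True
      have "(\<integral>\<^sup>+s. ennreal (exp (- s)) * indicator {0<..} s
          * (ennreal (exp (- t) / t) * indicator {c / s..} t) \<partial>lborel)
        = (\<integral>\<^sup>+s\<in>{c / t..}. ennreal (exp (- t) / t * exp (- s)) \<partial>lborel)"
      proof (rule nn_integral_cong)
        fix s :: real
        \<comment> \<open>The region above the hyperbola \<open>s * t = c\<close> in the positive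
          quadrant, described from the other axis.\<close>
        have "s > 0 \<and> c / s \<le> t \<longleftrightarrow> c / t \<le> s"
        proof
          assume *: "c / t \<le> s"
          then have "s > 0" using True c by (meson divide_pos_pos less_le_trans)
          then show "s > 0 \<and> c / s \<le> t" using * True by (simp add: field_simps)
        qed (use True in \<open>auto simp: pos_divide_le_eq mult.commute\<close>)
        then show "ennreal (exp (- s)) * indicator {0<..} s
            * (ennreal (exp (- t) / t) * indicator {c / s..} t)
           = ennreal (exp (- t) / t * exp (- s)) * indicator {c / t..} s"
          using True by (auto split: split_indicator simp: ennreal_mult[symmetric] mult.commute)
      qed
      also have "\<dots> = ennreal (0 - (- (exp (- t) / t * exp (- (c / t)))))"
      proof (rule nn_integral_FTC_atLeast)
        show "((\<lambda>s. - (exp (- t) / t * exp (- s))) \<longlongrightarrow> 0) at_top" using True by real_asymp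
      qed (use True in \<open>auto intro!: derivative_eq_intros\<close>)
      also have "0 - (- (exp (- t) / t * exp (- (c / t)))) = exp (- t - c / t) / t"
        by (simp add: exp_add[symmetric])
      finally show ?thesis using True by simp
    next
      case False
      have "(\<integral>\<^sup>+s. ennreal (exp (- s)) * indicator {0<..} s
          * (ennreal (exp (- t) / t) * indicator {c / s..} t) \<partial>lborel) = (\<integral>\<^sup>+s. 0 \<partial>(lborel :: real measure))"
        using False by (intro nn_integral_cong) (auto split: split_indicator simp: ennreal_neg divide_nonneg_nonpos)
      with False show ?thesis by simp
    qed
  qed
  finally show ?thesis by (simp add: nn_integral_bessel_K_0[OF c])
qed

text \<open>The quotient \<open>Y / X\<close> exceeds \<open>t\<close> with probability equal to the
  mean of \<open>exp (- (t * X))\<close>, that is \<open>1 / (t + 1)\<close>. By partial fractions,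
  \<open>ln t - ln (t + 1)\<close> is an antiderivative of this tail over \<open>t\<close>.\<close>

lemma (in prob_space) nn_integral_ln_max_exponential_quotient:
  assumes X: "distributed M lborel X (\<lambda>x. ennreal (exponential_density 1 x))"
    and Y: "distributed M lborel Y (\<lambda>x. ennreal (exponential_density 1 x))"
    and XY: "indep_pair borel X borel Y" and c: "c > 0"
  shows "(\<integral>\<^sup>+x. ennreal (ln (max 1 (Y x / (c * X x)))) \<partial>M) = ennreal (ln (1 + 1 / c))"
proof -
  have [measurable]: "X \<in> borel_measurable M" "Y \<in> borel_measurable M"
    using X Y by (auto simp: distributed_def)
  have pms: "pair_sigma_finite M (lborel :: real measure)"
    by (intro pair_sigma_finite.intro sigma_finite_measure_axioms sigma_finite_lborel)
  have "(\<integral>\<^sup>+x. ennreal (ln (max 1 (Y x / (c * X x)))) \<partial>M)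
      = (\<integral>\<^sup>+x. \<integral>\<^sup>+t. ennreal (1 / t) * indicator {c..} t * indicator {t * X x..} (Y x) \<partial>lborel \<partial>M)"
  proof (rule nn_integral_cong_AE, use AE_exponential_pos[OF X] AE_exponential_pos[OF Y] in eventually_elim)
    fix x assume x: "0 < X x" "0 < Y x"
    then have "ennreal (ln (max 1 (Y x / X x / c)))
        = (\<integral>\<^sup>+t\<in>{c..}. ennreal (1 / t) * indicator {..Y x / X x} t \<partial>lborel)"
      using c by (intro ennreal_ln_max_layer_cake) auto
    also have "\<dots> = (\<integral>\<^sup>+t. ennreal (1 / t) * indicator {c..} t * indicator {t
        * X x..} (Y x) \<partial>lborel)"
      using x by (intro nn_integral_cong) (auto split: split_indicator simp: field_simps)
    finally show "ennreal (ln (max 1 (Y x / (c * X x)))) = \<dots>" by (simp add: mult.commute)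
  qed
  also have "\<dots> = (\<integral>\<^sup>+t. \<integral>\<^sup>+x. ennreal (1 / t) * indicator {c..} t * indicator {t
      * X x..} (Y x) \<partial>M \<partial>lborel)"
    by (rule pair_sigma_finite.Fubini'[OF pms, symmetric]) (simp add: indicator_def atLeast_def)
  also have "\<dots> = (\<integral>\<^sup>+t\<in>{c..}. ennreal (1 / (t * (t + 1))) \<partial>lborel)"
  proof (rule nn_integral_cong)
    fix t :: real
    show "(\<integral>\<^sup>+x. ennreal (1 / t) * indicator {c..} t * indicator {t * X x..} (Y x) \<partial>M)
        = ennreal (1 / (t * (t + 1))) * indicator {c..} t"
    proof (cases "c \<le> t")
      case True
      have "(\<integral>\<^sup>+x. indicator {t * X x..} (Y x) \<partial>M)
          = (\<integral>\<^sup>+x. \<integral>\<^sup>+y. indicator {t * X x..} (Y y) \<partial>M \<partial>M)"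
        by (rule nn_integral_indep_pair[OF XY]) (simp add: indicator_def atLeast_def)
      also have "\<dots> = (\<integral>\<^sup>+x. ennreal (exp (- (t * X x))) \<partial>M)"
      proof (rule nn_integral_cong_AE, use AE_exponential_pos[OF X] in eventually_elim)
        fix x assume "0 < X x"
        then show "(\<integral>\<^sup>+y. indicator {t * X x..} (Y y) \<partial>M) = ennreal (exp (- (t * X x)))"
          using True c by (intro exponential_tail[OF Y]) auto
      qed
      also have "\<dots> = (\<integral>\<^sup>+s\<in>{0..}. ennreal (exp (- s)) * ennreal (exp (- (t * s))) \<partial>lborel)"
        by (rule nn_integral_exponential[OF X]) measurable
      also have "\<dots> = (\<integral>\<^sup>+s\<in>{0..}. ennreal (exp (- (t + 1) * s)) \<partial>lborel)"
        by (intro nn_integral_cong) (auto simp: ennreal_mult[symmetric] exp_add[symmetric] algebra_simps)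
      also have "\<dots> = ennreal (1 / (t + 1))"
        using True c by (intro nn_integral_exp_decay) auto
      finally have "(\<integral>\<^sup>+x. indicator {t * X x..} (Y x) \<partial>M) = ennreal (1 / (t + 1))" .
      then show ?thesis using True c
        by (subst nn_integral_cmult) (auto simp: ennreal_mult[symmetric] indicator_def atLeast_def)
    qed simp
  qed
  also have "\<dots> = ennreal (0 - (ln c - ln (c + 1)))"
  proof (rule nn_integral_FTC_atLeast)
    show "((\<lambda>t. ln t - ln (t + 1)) \<longlongrightarrow> (0::real)) at_top" by real_asymp
  qed (use c in \<open>auto intro!: derivative_eq_intros simp: field_simps\<close>)
  also have "0 - (ln c - ln (c + 1)) = ln (1 + 1 / c)"
  proof -
    have "1 + 1 / c = (c + 1) / c" using c by (simp add: field_simps)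
    then show ?thesis using c by (simp add: ln_div)
  qed
  finally show ?thesis .
qed

text \<open>The layer-cake formula applies to the shifted variable \<open>X + k\<close> with
  threshold \<open>k\<close>; its tail \<open>exp (k - t)\<close> for \<open>t \<ge> k\<close> is
  the source of the factor \<open>exp k\<close>.\<close>

lemma (in prob_space) nn_integral_ln_add_exponential:
  assumes X: "distributed M lborel X (\<lambda>x. ennreal (exponential_density 1 x))" and k: "k > 0"
  shows "(\<integral>\<^sup>+x. ennreal (ln (1 + X x / k)) \<partial>M) = ennreal (exp k * exp_integral_E1 k)"
proof -
  have [measurable]: "X \<in> borel_measurable M" using X by (auto simp: distributed_def)
  have pms: "pair_sigma_finite M (lborel :: real measure)"
    by (intro pair_sigma_finite.intro sigma_finite_measure_axioms sigma_finite_lborel)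
  have "(\<integral>\<^sup>+x. ennreal (ln (1 + X x / k)) \<partial>M)
     = (\<integral>\<^sup>+x. \<integral>\<^sup>+t. ennreal (1 / t) * indicator {k..} t * indicator {t - k..} (X x) \<partial>lborel \<partial>M)"
  proof (rule nn_integral_cong_AE, use AE_exponential_pos[OF X] in eventually_elim)
    fix x assume x: "0 < X x"
    then have eq: "ln (1 + X x / k) = ln (max 1 ((X x + k) / k))"
      using k by (simp add: add_divide_distrib add.commute)
    have "ennreal (ln (1 + X x / k))
        = (\<integral>\<^sup>+t\<in>{k..}. ennreal (1 / t) * indicator {..X x + k} t \<partial>lborel)"
      unfolding eq using k x by (intro ennreal_ln_max_layer_cake) auto
    also have "\<dots> = (\<integral>\<^sup>+t. ennreal (1 / t) * indicator {k..} t
        * indicator {t - k..} (X x) \<partial>lborel)"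
      by (intro nn_integral_cong) (auto split: split_indicator)
    finally show "ennreal (ln (1 + X x / k)) = \<dots>" .
  qed
  also have "\<dots> = (\<integral>\<^sup>+t. \<integral>\<^sup>+x. ennreal (1 / t) * indicator {k..} t
      * indicator {t - k..} (X x) \<partial>M \<partial>lborel)"
    by (rule pair_sigma_finite.Fubini'[OF pms, symmetric]) (simp add: indicator_def atLeast_def)
  also have "\<dots> = (\<integral>\<^sup>+t. ennreal (exp k) * (ennreal (exp (- t) / t) * indicator {k..} t) \<partial>lborel)"
  proof (rule nn_integral_cong)
    fix t :: real
    have "(\<integral>\<^sup>+x. ennreal (1 / t) * indicator {k..} t * indicator {t - k..} (X x) \<partial>M)
        = ennreal (1 / t) * indicator {k..} t * (\<integral>\<^sup>+x. indicator {t - k..} (X x) \<partial>M)"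
      by (rule nn_integral_cmult) measurable
    also have "\<dots> = ennreal (exp k) * (ennreal (exp (- t) / t) * indicator {k..} t)"
      using k by (auto simp: exponential_tail[OF X] ennreal_mult[symmetric] exp_diff exp_minus field_simps split: split_indicator)
    finally show "(\<integral>\<^sup>+x. ennreal (1 / t) * indicator {k..} t * indicator {t - k..} (X x) \<partial>M)
        = \<dots>" .
  qed
  also have "\<dots> = ennreal (exp k) * ennreal (exp_integral_E1 k)"
    by (subst nn_integral_cmult) (auto simp: nn_integral_exp_integral_E1[OF k])
  finally show ?thesis using nn_integral_exp_integral_E1(2)[OF k] by (simp add: ennreal_mult)
qed

section \<open>High SNR\<close>

lemma (in prob_space) exponential_moment:
  assumes X: "distributed M lborel X (\<lambda>x. ennreal (exponential_density 1 x))" and s: "s > -1"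
  shows "integrable M (\<lambda>x. X x powr s)" "expectation (\<lambda>x. X x powr s) = Gamma (s + 1)"
proof -
  have [measurable]: "X \<in> borel_measurable M" using X by (auto simp: distributed_def)
  have "(\<integral>\<^sup>+x. ennreal (X x powr s) \<partial>M)
      = (\<integral>\<^sup>+t\<in>{0..}. ennreal (exp (- t)) * ennreal (t powr s) \<partial>lborel)"
    by (rule nn_integral_exponential[OF X]) measurable
  also have "\<dots> = (\<integral>\<^sup>+t. ennreal (indicator {0..} t * t powr (s + 1 - 1) / exp t) \<partial>lborel)"
    by (intro nn_integral_cong)
       (auto split: split_indicator simp: ennreal_mult[symmetric] exp_minus field_simps)
  also have "\<dots> = ennreal (Gamma (s + 1))"
    using s by (subst Gamma_conv_nn_integral_real) auto
  finally have "integrable M (\<lambda>x. X x powr s) \<and> expectation (\<lambda>x. X x powr s) = Gamma (s + 1)"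
    using s by (subst (asm) nn_integral_eq_integrable) (auto intro: less_imp_le Gamma_real_pos)
  then show "integrable M (\<lambda>x. X x powr s)" "expectation (\<lambda>x. X x powr s) = Gamma (s + 1)"
    by auto
qed

text \<open>\<open>(X\<^sup>h - 1) / h\<close> tends to \<open>ln X\<close> as \<open>h \<rightarrow> 0\<close>, while its expectation is a difference quotient of
  \<open>\<Gamma>\<close> at \<open>1\<close>.\<close>

lemma (in prob_space) exponential_ln:
  assumes X: "distributed M lborel X (\<lambda>x. ennreal (exponential_density 1 x))"
  shows "integrable M (\<lambda>x. ln (X x))" and "expectation (\<lambda>x. ln (X x)) = - euler_mascheroni"
proof -
  have [measurable]: "X \<in> borel_measurable M" using X by (auto simp: distributed_def)
  \<comment> \<open>The bound of \<open>ln\<close> by its argument is applied to \<open>x\<close>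
    and to \<open>x powr (-1/2)\<close>. The exponent \<open>-1/2\<close> stays above
    \<open>-1\<close>, so the moment exists.\<close>
  have abs_ln_le: "\<bar>ln x\<bar> \<le> x powr 1 + 2 * x powr (-1/2)" if "x > 0" for x :: real
  proof -
    have "ln x \<le> x" using ln_bound[OF that] .
    moreover have "ln (x powr (-1/2)) \<le> x powr (-1/2)" using that by (intro ln_bound) simp
    then have "- ln x \<le> 2 * x powr (-1/2)" using that by (simp add: ln_powr)
    moreover have "0 \<le> x powr (-1/2)" by simp
    ultimately show ?thesis using that unfolding powr_one[OF less_imp_le[OF that]] by linarith
  qed
  show int: "integrable M (\<lambda>x. ln (X x))"
  proof (rule Bochner_Integration.integrable_bound)
    show "integrable M (\<lambda>x. X x powr 1 + 2 * X x powr (-1/2))"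
      using exponential_moment(1)[OF X, of 1] exponential_moment(1)[OF X, of "-1/2"] by auto
    show "AE x in M. norm (ln (X x)) \<le> norm (X x powr 1 + 2 * X x powr (-1/2))"
      using AE_exponential_pos[OF X]
    proof eventually_elim
      case (elim x)
      show ?case using abs_ln_le[OF elim] by (smt (verit) powr_ge_zero real_norm_def)
    qed
  qed measurable
  define h where "h = (\<lambda>n::nat. 1 / real (Suc n))"
  have h0: "0 < h n" "h n \<le> 1" for n by (auto simp: h_def)
  have h_lim: "filterlim h (at 0) sequentially"
    unfolding h_def by real_asymp
  have lim1: "(\<lambda>n. expectation (\<lambda>x. (X x powr h n - 1) / h n)) \<longlonglongrightarrow> expectation (\<lambda>x. ln (X x))"
  proof (rule integral_dominated_convergence)
    show "integrable M (\<lambda>x. \<bar>ln (X x)\<bar> + X x powr 2)"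
      using int exponential_moment(1)[OF X, of 2] by auto
    show "AE x in M. (\<lambda>n. (X x powr h n - 1) / h n) \<longlonglongrightarrow> ln (X x)"
      using AE_exponential_pos[OF X]
    proof eventually_elim
      case (elim x)
      have "((\<lambda>s. X x powr s) has_real_derivative ln (X x)) (at 0)"
        using elim by (auto intro!: derivative_eq_intros)
      then have "((\<lambda>s. (X x powr s - 1) / s) \<longlongrightarrow> ln (X x)) (at 0)"
        using elim by (simp add: has_field_derivative_iff)
      from filterlim_compose[OF this h_lim] show ?case .
    qed
    show "AE x in M. norm ((X x powr h n - 1) / h n) \<le> \<bar>ln (X x)\<bar> + X x powr 2" for n
      using AE_exponential_pos[OF X]
    proof eventually_elim
      case (elim x)
      let ?u = "h n * ln (X x)"
      have pw: "X x powr h n = exp ?u" using elim by (simp add: powr_def)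
      \<comment> \<open>This inequality at \<open>?u\<close> and at \<open>- ?u\<close> encloses the
        difference quotient between \<open>ln (X x)\<close> and
        \<open>ln (X x) * X x powr h n\<close>. As \<open>h n \<le> 1\<close>, the upper end is at
        most \<open>X x powr 2\<close> when \<open>X x \<ge> 1\<close>, and at most 0
        otherwise.\<close>
      have "1 + ?u \<le> exp ?u" by (rule exp_ge_add_one_self)
      then have "h n * ln (X x) \<le> X x powr h n - 1" unfolding pw by linarith
      then have lower: "ln (X x) \<le> (X x powr h n - 1) / h n"
        using h0[of n] by (simp add: field_simps)
      have "1 - ?u \<le> exp (- ?u)" using exp_ge_add_one_self[of "- ?u"] by simp
      then have "(1 - ?u) * exp ?u \<le> exp (- ?u) * exp ?u" by (rule mult_right_mono) simp
      then have "exp ?u - 1 \<le> h n * (ln (X x) * exp ?u)"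
        by (simp add: exp_add[symmetric] algebra_simps)
      then have upper: "(X x powr h n - 1) / h n \<le> ln (X x) * X x powr h n"
        using h0[of n] unfolding pw by (simp add: field_simps)
      have "ln (X x) * X x powr h n \<le> X x powr 2"
      proof (cases "X x \<ge> 1")
        case True
        have "ln (X x) * X x powr h n \<le> X x powr 1 * X x powr 1"
          using True h0[of n] elim ln_bound[of "X x"]
          by (intro mult_mono powr_mono) auto
        then show ?thesis unfolding powr_add[symmetric] by simp
      next
        case False
        then have "ln (X x) * X x powr h n \<le> 0" using elim by (intro mult_nonpos_nonneg) auto
        then show ?thesis by (smt (verit) powr_ge_zero)
      qed
      with lower upper show ?case by (smt (verit) powr_ge_zero real_norm_def)
    qed
  qed measurable
  have eq: "expectation (\<lambda>x. (X x powr h n - 1) / h n) = (Gamma (1 + h n) - Gamma 1) / h n" for n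
    using exponential_moment[OF X, of "h n"] h0[of n] by (simp add: prob_space add.commute)
  have lim2: "(\<lambda>n. (Gamma (1 + h n) - Gamma 1) / h n) \<longlonglongrightarrow> Gamma 1 * Digamma (1::real)"
  proof -
    have "(Gamma has_real_derivative Gamma 1 * Digamma 1) (at (1::real))"
      by (rule has_field_derivative_Gamma) simp
    then have "((\<lambda>s. (Gamma (1 + s) - Gamma 1) / s) \<longlongrightarrow> Gamma 1 * Digamma (1::real)) (at 0)"
      by (simp add: DERIV_def)
    from filterlim_compose[OF this h_lim] show ?thesis .
  qed
  show "expectation (\<lambda>x. ln (X x)) = - euler_mascheroni"
    using LIMSEQ_unique[OF lim1[unfolded eq] lim2] by simp
qed

text \<open>With \<open>Y\<close> the squared modulus, \<open>1 + g * Y = g * (1 / g + Y)\<close>.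
  Hence the capacity minus \<open>log 2 g\<close> is the expectation of
  \<open>ln (1 / g + Y)\<close> divided by \<open>ln 2\<close>, and only \<open>1 / g\<close> has to
  tend to 0.\<close>

lemma (in prob_space) high_snr_approx_avg_capacity:
  assumes [measurable]: "S \<in> borel_measurable M"
    and int: "integrable M (\<lambda>x. ln ((cmod (S x))\<^sup>2))" and S0: "AE x in M. S x \<noteq> 0"
  shows "high_snr_approx (\<lambda>g. avg_capacity M (inst_snr g S))
           (\<lambda>g. log 2 g + expectation (\<lambda>x. ln ((cmod (S x))\<^sup>2)) / ln 2)"
proof -
  define Y where "Y = (\<lambda>x. (cmod (S x))\<^sup>2)"
  have [measurable]: "Y \<in> borel_measurable M" unfolding Y_def by measurable
  have Y0: "0 \<le> Y x" for x by (simp add: Y_def)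
  have intY: "integrable M (\<lambda>x. ln (Y x))" using int by (simp add: Y_def)
  have Ypos: "AE x in M. 0 < Y x" using S0 by eventually_elim (simp add: Y_def)
  \<comment> \<open>For \<open>g \<ge> 1\<close> the argument lies between \<open>Y x\<close> and
    \<open>2 * max 1 (Y x)\<close>, which gives a dominating function free of
    \<open>g\<close>.\<close>
  have bound: "AE x in M. norm (ln (1 / g + Y x)) \<le> ln 2 + \<bar>ln (Y x)\<bar>" if g: "g \<ge> 1" for g :: real
    using Ypos
  proof eventually_elim
    case (elim x)
    have g': "0 < 1 / g" "1 / g \<le> 1" using g by auto
    have "ln (Y x) \<le> ln (1 / g + Y x)" using elim g'
      by (subst ln_le_cancel_iff) (simp_all add: add_pos_pos)
    moreover have "ln (1 / g + Y x) \<le> ln (2 * max 1 (Y x))"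
    proof -
      have "1 / g \<le> max 1 (Y x)" using g'(2) by (rule order_trans) simp
      then have "1 / g + Y x \<le> 2 * max 1 (Y x)" by simp
      then show ?thesis using elim g'(1) by (subst ln_le_cancel_iff) (simp_all add: add_pos_pos)
    qed
    moreover have "ln (2 * max 1 (Y x)) = ln 2 + ln (max 1 (Y x))" by (subst ln_mult) auto
    moreover have "ln (max 1 (Y x)) \<le> \<bar>ln (Y x)\<bar>" by (auto simp: max_def)
    moreover have "0 < ln (2::real)" by simp
    ultimately show ?case unfolding real_norm_def by linarith
  qed
  have dom: "integrable M (\<lambda>x. ln 2 + \<bar>ln (Y x)\<bar>)" using intY by auto
  have "((\<lambda>g. expectation (\<lambda>x. ln (1 / g + Y x))) \<longlongrightarrow> expectation (\<lambda>x. ln (Y x))) at_top"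
  proof (rule integral_dominated_convergence_at_top[OF _ _ dom])
    show "AE x in M. ((\<lambda>g. ln (1 / g + Y x)) \<longlongrightarrow> ln (Y x)) at_top"
      using Ypos
    proof eventually_elim
      case (elim x)
      have "((\<lambda>g::real. 1 / g + Y x) \<longlongrightarrow> Y x) at_top" by real_asymp
      then show ?case using elim by (intro tendsto_ln) auto
    qed
    show "\<forall>\<^sub>F g in at_top. AE x in M. norm (ln (1 / g + Y x)) \<le> ln 2 + \<bar>ln (Y x)\<bar>"
      using eventually_ge_at_top[of 1] by eventually_elim (rule bound)
  qed measurable
  then have "((\<lambda>g. (expectation (\<lambda>x. ln (1 / g + Y x)) - expectation (\<lambda>x. ln (Y x))) / ln 2)
      \<longlongrightarrow> 0) at_top"
    by (intro tendsto_eq_intros) auto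
  moreover have "\<forall>\<^sub>F g in at_top. (expectation (\<lambda>x. ln (1 / g
      + Y x)) - expectation (\<lambda>x. ln (Y x))) / ln 2
      = avg_capacity M (inst_snr g S) - (log 2 g + expectation (\<lambda>x. ln (Y x)) / ln 2)"
    using eventually_ge_at_top[of 1]
  proof eventually_elim
    case (elim g)
    have intg: "integrable M (\<lambda>x. ln (1 / g + Y x))"
    proof (rule Bochner_Integration.integrable_bound[OF dom])
      show "AE x in M. norm (ln (1 / g + Y x)) \<le> norm (ln 2 + \<bar>ln (Y x)\<bar>)"
        using bound[OF elim] by eventually_elim auto
    qed measurable
    have "avg_capacity M (inst_snr g S)
        = expectation (\<lambda>x. indicator {0..} (g * Y x) *\<^sub>R log 2 (1 + g * Y x))"
      unfolding avg_capacity_def set_lebesgue_integral_def inst_snr_def Y_def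
      by (rule integral_distr) measurable
    also have "\<dots> = expectation (\<lambda>x. (ln g + ln (1 / g + Y x)) / ln 2)"
    proof (rule Bochner_Integration.integral_cong[OF refl])
      fix x
      have "1 + g * Y x = g * (1 / g + Y x)" using elim by (simp add: field_simps)
      moreover have "0 < 1 / g" using elim by simp
      then have "0 < 1 / g + Y x" using Y0[of x] by linarith
      then have "ln (g * (1 / g + Y x)) = ln g + ln (1 / g + Y x)"
        using elim by (subst ln_mult) auto
      ultimately show "indicator {0..} (g * Y x) *\<^sub>R log 2 (1 + g * Y x)
          = (ln g + ln (1 / g + Y x)) / ln 2"
        using elim Y0[of x] by (simp add: log_def)
    qed
    also have "\<dots> = (ln g + expectation (\<lambda>x. ln (1 / g + Y x))) / ln 2"
      using intg by (simp add: prob_space)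
    finally show ?case by (simp add: log_def add_divide_distrib diff_divide_distrib)
  qed
  ultimately have "((\<lambda>g. avg_capacity M (inst_snr g S) - (log 2 g
      + expectation (\<lambda>x. ln (Y x)) / ln 2)) \<longlongrightarrow> 0) at_top"
    by (rule Lim_transform_eventually)
  then show ?thesis unfolding high_snr_approx_def Y_def .
qed

text \<open>Brings the maximum produced by Jensen's formula into the normalised form of the
  layer-cake lemmas, with threshold \<open>a / b\<close>.\<close>

lemma ln_max_scale:
  fixes a b y :: real
  assumes "a > 0" "b > 0"
  shows "ln (max a (b * y)) = ln a + ln (max 1 (y / (a / b)))"
proof -
  have "max a (b * y) = a * max 1 (y / (a / b))"
    using assms by (auto simp: max_def field_simps)
  then show ?thesis using assms by (simp add: ln_mult)
qed

lemma (in prob_space) nn_integral_eq_expectation: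
  assumes "(\<integral>\<^sup>+x. ennreal (f x) \<partial>M) = ennreal r" "f \<in> borel_measurable M" "\<And>x. 0 \<le> f x" "0 \<le> r"
  shows "integrable M f" "expectation f = r"
  using assms by (auto simp: nn_integral_eq_integrable)

text \<open>The strict inequalities keep the first three formulas away from parameters where they
  would divide by zero or take the logarithm of zero. Those endpoints are exactly the last three
  cases.\<close>

theorem mainTheorem6:
  fixes M :: "'a measure" and \<phi> :: "'a \<Rightarrow> real" and G1 G2 G3 :: "'a \<Rightarrow> complex"
    and \<omega>0 \<omega>1 \<omega>2 \<alpha> \<beta> :: real and C :: "real \<Rightarrow> real"
  assumes "sosf_channel M \<phi> G1 G2 G3 \<omega>0 \<omega>1 \<omega>2"
    and "\<alpha> = \<omega>2\<^sup>2" and "\<beta> = \<omega>0\<^sup>2"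
    and "\<And>\<gamma>bar. C \<gamma>bar = avg_capacity M (inst_snr \<gamma>bar (sosf_signal \<phi> G1 G2 G3 \<omega>0 \<omega>1 \<omega>2))"
  shows "(\<alpha> = 0 \<and> 0 < \<beta> \<and> \<beta> < 1 \<longrightarrow>
      high_snr_approx C (\<lambda>\<gamma>bar. log 2 \<gamma>bar + log 2 \<beta>
        + log 2 (exp 1) * exp_integral_E1 (\<beta> / (1 - \<beta>))))
    \<and> (\<alpha> + \<beta> = 1 \<and> 0 < \<beta> \<and> \<beta> < 1 \<longrightarrow>
      high_snr_approx C (\<lambda>\<gamma>bar. log 2 \<gamma>bar + log 2 \<beta>
        + 2 * log 2 (exp 1) * bessel_K 0 (2 * sqrt (\<beta> / (1 - \<beta>)))))
    \<and> (\<beta> = 0 \<and> 0 < \<alpha> \<and> \<alpha> < 1 \<longrightarrow>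
      high_snr_approx C (\<lambda>\<gamma>bar. log 2 \<gamma>bar - log 2 (exp 1) * euler_mascheroni + log 2 (1 - \<alpha>)
        + log 2 (exp 1) * exp ((1 - \<alpha>) / \<alpha>) * exp_integral_E1 ((1 - \<alpha>) / \<alpha>)))
    \<and> (\<alpha> = 0 \<and> \<beta> = 0 \<longrightarrow>
      high_snr_approx C (\<lambda>\<gamma>bar. log 2 \<gamma>bar - log 2 (exp 1) * euler_mascheroni))
    \<and> (\<alpha> = 1 \<and> \<beta> = 0 \<longrightarrow>
      high_snr_approx C (\<lambda>\<gamma>bar. log 2 \<gamma>bar - 2 * log 2 (exp 1) * euler_mascheroni))
    \<and> (\<alpha> = 0 \<and> \<beta> = 1 \<longrightarrow>
      high_snr_approx C (\<lambda>\<gamma>bar. log 2 \<gamma>bar))"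
proof -
  note \<alpha> = assms(2) and \<beta> = assms(3)
  from assms(1) interpret prob_space M by (simp add: sosf_channel_def)
  from assms(1) have nonneg: "0 \<le> \<omega>0" "0 \<le> \<omega>1" "0 \<le> \<omega>2" and sum1: "\<omega>0\<^sup>2 + \<omega>1\<^sup>2 + \<omega>2\<^sup>2 = 1"
    and phi[measurable]: "\<phi> \<in> borel_measurable M"
    and G: "cs_complex_gaussian M 1 G1" "cs_complex_gaussian M 1 G2" "cs_complex_gaussian M 1 G3"
    and indep: "indep_vars (\<lambda>_. borel) (\<lambda>k::nat. [\<lambda>x. complex_of_real (\<phi> x), G1, G2, G3] ! k) {..<4}"
    by (auto simp: sosf_channel_def)
  have \<omega>1: "\<omega>1\<^sup>2 = 1 - \<alpha> - \<beta>" using sum1 \<alpha> \<beta> by simp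
  have Gm[measurable]: "G1 \<in> borel_measurable M" "G2 \<in> borel_measurable M"
      "G3 \<in> borel_measurable M"
    using G by (auto simp: cs_complex_gaussian_def distributed_def)
  define S where "S = sosf_signal \<phi> G1 G2 G3 \<omega>0 \<omega>1 \<omega>2"
  define P where "P = (\<lambda>x. complex_of_real \<omega>0 * exp (\<i> * complex_of_real (\<phi> x)))"
  have [measurable]: "P \<in> borel_measurable M"
    unfolding P_def by (intro borel_measurable_times borel_measurable_const measurable_compose[OF _ borel_measurable_exp]) measurable
  have S: "S x = P x + of_real \<omega>1 * G1 x + of_real \<omega>2 * G2 x * G3 x" for x
    by (simp add: S_def P_def sosf_signal_def)
  have [measurable]: "S \<in> borel_measurable M" unfolding S[abs_def] by measurable
  have P: "(cmod (P x))\<^sup>2 = \<beta>" for x by (simp add: P_def norm_mult \<beta>)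
  define X1 X2 X3 where "X1 = (\<lambda>x. (cmod (G1 x))\<^sup>2)" and "X2 = (\<lambda>x. (cmod (G2 x))\<^sup>2)"
    and "X3 = (\<lambda>x. (cmod (G3 x))\<^sup>2)"
  have [measurable]: "X1 \<in> borel_measurable M" "X2 \<in> borel_measurable M" "X3 \<in> borel_measurable M"
    unfolding X1_def X2_def X3_def by measurable
  have X: "distributed M lborel X1 (\<lambda>x. ennreal (exponential_density 1 x))"
    "distributed M lborel X2 (\<lambda>x. ennreal (exponential_density 1 x))"
    "distributed M lborel X3 (\<lambda>x. ennreal (exponential_density 1 x))"
    unfolding X1_def X2_def X3_def by (intro cs_complex_gaussian_exponential G)+
  have X0: "0 \<le> X1 x" "0 \<le> X2 x" "0 \<le> X3 x" for x by (auto simp: X1_def X2_def X3_def)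
  note Xpos = X[THEN AE_exponential_pos]
  note lnX = X[THEN exponential_ln(1)] X[THEN exponential_ln(2)]
  have rest: "indep_pair (PiM J (\<lambda>_. borel)) (\<lambda>x. \<lambda>k\<in>J. ([\<lambda>x. complex_of_real (\<phi> x), G1, G2, G3] ! k) x)
     (PiM K (\<lambda>_. borel)) (\<lambda>x. \<lambda>k\<in>K. ([\<lambda>x. complex_of_real (\<phi> x), G1, G2, G3] ! k) x)"
    if "J \<subseteq> {..<4}" "K \<subseteq> {..<4}" "J \<inter> K = {}" for J K
    by (rule indep_vars_imp_indep_pair[OF indep that])
  have expm: "(\<lambda>F. complex_of_real \<omega>0 * exp (\<i> * F 0)) \<in> borel_measurable (PiM J (\<lambda>_. borel))"
    if "0 \<in> J" for J :: "nat set"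
  proof -
    have "(\<lambda>z. complex_of_real \<omega>0 * exp (\<i> * z)) \<in> borel_measurable borel"
      by (intro borel_measurable_continuous_onI continuous_intros)
    from measurable_compose[OF measurable_component_singleton[OF that] this] show ?thesis .
  qed
  \<comment> \<open>The roles of \<open>(A, B)\<close> and \<open>G\<close> in
    \<open>ln_cmod_add_gaussian\<close>. Wherever the product of two Gaussians occurs,
    \<open>G3\<close> is the rotated factor and \<open>G2\<close> belongs to the coefficient
    \<open>B\<close>.\<close>
  have PG1: "indep_pair borel (\<lambda>x. (P x, complex_of_real \<omega>1)) borel G1"
    using indep_pair_compose[OF rest[of "{0}" "{1}"],
    of "\<lambda>F. (complex_of_real \<omega>0 * exp (\<i> * F 0), complex_of_real \<omega>1)" borel
        "\<lambda>F. F 1" borel] expm[of "{0}"]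
    by (simp add: P_def borel_prod[symmetric])
  have PG2G3: "indep_pair borel (\<lambda>x. (P x, complex_of_real \<omega>2 * G2 x)) borel G3"
    using indep_pair_compose[OF rest[of "{0,2}" "{3}"],
    of "\<lambda>F. (complex_of_real \<omega>0 * exp (\<i> * F 0), complex_of_real \<omega>2 * F 2)" borel
        "\<lambda>F. F 3" borel] expm[of "{0,2}"]
    by (simp add: P_def borel_prod[symmetric])
  have G1G2G3: "indep_pair borel (\<lambda>x. (complex_of_real \<omega>1 * G1 x, complex_of_real \<omega>2
      * G2 x)) borel G3"
    using indep_pair_compose[OF rest[of "{1,2}" "{3}"],
    of "\<lambda>F. (complex_of_real \<omega>1 * F 1, complex_of_real \<omega>2 * F 2)" borel "\<lambda>F. F 3" borel]
    by (simp add: borel_prod[symmetric])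
  have X2X3: "indep_pair borel X2 borel X3"
    using indep_pair_compose[OF rest[of "{2}" "{3}"],
    of "\<lambda>F. (cmod (F 2))\<^sup>2" borel "\<lambda>F. (cmod (F 3))\<^sup>2" borel]
    by (simp add: X2_def X3_def)
  have X1X3: "indep_pair borel X1 borel X3"
    using indep_pair_compose[OF rest[of "{1}" "{3}"],
    of "\<lambda>F. (cmod (F 1))\<^sup>2" borel "\<lambda>F. (cmod (F 3))\<^sup>2" borel]
    by (simp add: X1_def X3_def)
  have X2X1X3: "indep_pair borel X2 borel (\<lambda>x. (X1 x, X3 x))"
    using indep_pair_compose[OF rest[of "{2}" "{1,3}"],
    of "\<lambda>F. (cmod (F 2))\<^sup>2" borel "\<lambda>F. ((cmod (F 1))\<^sup>2, (cmod (F 3))\<^sup>2)" borel]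
    by (simp add: X1_def X2_def X3_def borel_prod[symmetric])
  have C: "C = (\<lambda>g. avg_capacity M (inst_snr g S))" using assms(4) by (simp add: S_def fun_eq_iff)
  have reduce: "high_snr_approx C R"
    if "integrable M (\<lambda>x. ln ((cmod (S x))\<^sup>2))" "AE x in M. S x \<noteq> 0"
      "expectation (\<lambda>x. ln ((cmod (S x))\<^sup>2)) = r" "\<And>g. R g = log 2 g + r / ln 2" for R r
    using high_snr_approx_avg_capacity[OF _ that(1,2)] that(3) that(4)[abs_def] by (simp add: C)
  show ?thesis
  proof (intro conjI impI; elim conjE)
    assume *: "\<alpha> = 0" "0 < \<beta>" "\<beta> < 1"
    \<comment> \<open>The ratio of the line-of-sight power to the scattered power: the value that
      \<open>X1\<close> must exceed for the scattered term to win the maximum.\<close>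
    let ?c = "\<beta> / (1 - \<beta>)"
    have c: "?c > 0" using * by simp
    have \<omega>: "\<omega>2 = 0" "\<omega>1\<^sup>2 = 1 - \<beta>" using * \<alpha> \<omega>1 by auto
    have eq: "ln (max ((cmod (P x))\<^sup>2) ((cmod (of_real \<omega>1 * G1 x))\<^sup>2))
        = ln \<beta> + ln (max 1 (X1 x / ?c))" for x
      using ln_max_scale[of \<beta> "1 - \<beta>" "X1 x"] * \<omega>
      by (simp add: P norm_mult power_mult_distrib X1_def)
    note E = nn_integral_eq_expectation[OF nn_integral_ln_max_exponential[OF X(1) c] _ _ nn_integral_exp_integral_E1(2)[OF c]]
    have P0: "AE x in M. P x \<noteq> 0 \<or> of_real \<omega>1 * G1 x \<noteq> 0"
      using P * by (intro AE_I2 disjI1) (metis norm_zero power_zero_numeral less_irrefl)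
    have int: "integrable M (\<lambda>x. ln (max ((cmod (P x))\<^sup>2) ((cmod (of_real \<omega>1 * G1 x))\<^sup>2)))"
      unfolding eq using E(1) by simp
    note * = ln_cmod_add_gaussian[OF PG1 G(1) P0 int]
    have S': "S x = P x + of_real \<omega>1 * G1 x" for x by (simp add: S \<omega>)
    show "high_snr_approx C (\<lambda>\<gamma>bar. log 2 \<gamma>bar + log 2 \<beta> + log 2 (exp 1) * exp_integral_E1 ?c)"
    proof (rule reduce)
      show "integrable M (\<lambda>x. ln ((cmod (S x))\<^sup>2))" "AE x in M. S x \<noteq> 0"
        using * by (simp_all add: S')
      show "expectation (\<lambda>x. ln ((cmod (S x))\<^sup>2)) = ln \<beta> + exp_integral_E1 ?c"
        unfolding S' *(2) eq using E by (simp add: prob_space)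
    qed (simp add: log_def add_divide_distrib)
  next
    assume *: "\<alpha> + \<beta> = 1" "0 < \<beta>" "\<beta> < 1"
    let ?c = "\<beta> / (1 - \<beta>)"
    have c: "?c > 0" using * by simp
    have "\<omega>1\<^sup>2 = 0" using *(1) \<omega>1 by linarith
    then have \<omega>: "\<omega>1 = 0" "\<omega>2\<^sup>2 = 1 - \<beta>" using * \<alpha> by auto
    have eq: "ln (max ((cmod (P x))\<^sup>2) ((cmod (of_real \<omega>2 * G2 x * G3 x))\<^sup>2))
        = ln \<beta> + ln (max 1 (X2 x * X3 x / ?c))" for x
      using ln_max_scale[of \<beta> "1 - \<beta>" "X2 x * X3 x"] * \<omega>
      by (simp add: P norm_mult power_mult_distrib X2_def X3_def mult.assoc)
    note E = nn_integral_eq_expectation[OF nn_integral_ln_max_exponential_product[OF X(2,3) X2X3 c]]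
    have K: "0 \<le> 2 * bessel_K 0 (2 * sqrt ?c)" using nn_integral_bessel_K_0(2)[OF c] by simp
    have P0: "AE x in M. P x \<noteq> 0 \<or> of_real \<omega>2 * G2 x * G3 x \<noteq> 0"
      using P * by (intro AE_I2 disjI1) (metis norm_zero power_zero_numeral less_irrefl)
    have int: "integrable M (\<lambda>x. ln (max ((cmod (P x))\<^sup>2) ((cmod (of_real \<omega>2 * G2 x * G3 x))\<^sup>2)))"
      unfolding eq using E(1) K by simp
    note * = ln_cmod_add_gaussian[OF PG2G3 G(3) P0 int]
    have S': "S x = P x + of_real \<omega>2 * G2 x * G3 x" for x by (simp add: S \<omega>)
    show "high_snr_approx C (\<lambda>\<gamma>bar. log 2 \<gamma>bar + log 2 \<beta> + 2 * log 2 (exp 1)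
        * bessel_K 0 (2 * sqrt ?c))"
    proof (rule reduce)
      show "integrable M (\<lambda>x. ln ((cmod (S x))\<^sup>2))" "AE x in M. S x \<noteq> 0"
        using * by (simp_all add: S')
      show "expectation (\<lambda>x. ln ((cmod (S x))\<^sup>2)) = ln \<beta> + 2 * bessel_K 0 (2 * sqrt ?c)"
        unfolding S' *(2) eq using E K by (simp add: prob_space)
    qed (simp add: log_def add_divide_distrib)
  next
    assume *: "\<beta> = 0" "0 < \<alpha>" "\<alpha> < 1"
    \<comment> \<open>The power ratio of the single to the double Rayleigh term.\<close>
    let ?k = "(1 - \<alpha>) / \<alpha>"
    have k: "?k > 0" using * by simp
    have \<omega>: "\<omega>0 = 0" "\<omega>1\<^sup>2 = 1 - \<alpha>" "\<omega>1 \<noteq> 0" using * \<beta> \<omega>1 by auto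
    \<comment> \<open>Here the term taken out of the maximum is random. Its logarithm contributes
      \<open>ln (1 - \<alpha>)\<close> and, through \<open>ln (X1 x)\<close>, Euler's constant; the
      identity needs \<open>X1 x > 0\<close>.\<close>
    have eq: "AE x in M. ln (max ((cmod (of_real \<omega>1 * G1 x))\<^sup>2) ((cmod (of_real \<omega>2 * G2 x
        * G3 x))\<^sup>2))
       = ln (1 - \<alpha>) + ln (X1 x) + ln (max 1 (X2 x * X3 x / (?k * X1 x)))"
      using Xpos(1)
    proof eventually_elim
      case (elim x)
      then show ?case
        using ln_max_scale[of "(1 - \<alpha>) * X1 x" \<alpha> "X2 x * X3 x"] * \<omega>(2) \<alpha>[symmetric]
        by (simp add: norm_mult power_mult_distrib X1_def X2_def X3_def mult.assoc ln_mult)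
    qed
    \<comment> \<open>With \<open>X2\<close> fixed, the quotient of \<open>X3\<close> and
      \<open>X1\<close> is compared with the threshold \<open>?k / X2 x\<close>. Its mean positive
      logarithm is \<open>ln (1 + X2 x / ?k)\<close>, and averaging this over \<open>X2\<close>
      gives the \<open>E\<^sub>1\<close> term.\<close>
    have "(\<integral>\<^sup>+x. ennreal (ln (max 1 (X2 x * X3 x / (?k * X1 x)))) \<partial>M)
        = (\<integral>\<^sup>+x. \<integral>\<^sup>+y. ennreal (ln (max 1 (X2 x * X3 y / (?k * X1 y)))) \<partial>M \<partial>M)"
      using nn_integral_indep_pair[OF X2X1X3,
      of "\<lambda>x yz. ennreal (ln (max 1 (x * snd yz / (?k * fst yz))))"]
      by (simp add: borel_prod[symmetric])
    also have "\<dots> = (\<integral>\<^sup>+x. ennreal (ln (1 + X2 x / ?k)) \<partial>M)"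
    proof (rule nn_integral_cong_AE, use Xpos(2) in eventually_elim)
      fix x assume x: "0 < X2 x"
      have "X2 x * X3 y / (?k * X1 y) = X3 y / (?k / X2 x * X1 y)" for y by simp
      then have "(\<integral>\<^sup>+y. ennreal (ln (max 1 (X2 x * X3 y / (?k * X1 y)))) \<partial>M)
          = (\<integral>\<^sup>+y. ennreal (ln (max 1 (X3 y / (?k / X2 x * X1 y)))) \<partial>M)" by (simp only:)
      also have "\<dots> = ennreal (ln (1 + 1 / (?k / X2 x)))"
        by (rule nn_integral_ln_max_exponential_quotient[OF X(1,3) X1X3 divide_pos_pos[OF k x]])
      also have "1 / (?k / X2 x) = X2 x / ?k" by simp
      finally show "(\<integral>\<^sup>+y. ennreal (ln (max 1 (X2 x * X3 y / (?k * X1 y)))) \<partial>M)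
          = ennreal (ln (1 + X2 x / ?k))" .
    qed
    also have "\<dots> = ennreal (exp ?k * exp_integral_E1 ?k)"
      by (rule nn_integral_ln_add_exponential[OF X(2) k])
    finally have E: "(\<integral>\<^sup>+x. ennreal (ln (max 1 (X2 x * X3 x / (?k * X1 x)))) \<partial>M)
        = ennreal (exp ?k * exp_integral_E1 ?k)" .
    note E = nn_integral_eq_expectation[OF E]
    have E0: "0 \<le> exp ?k * exp_integral_E1 ?k" using nn_integral_exp_integral_E1(2)[OF k] by simp
    let ?L = "\<lambda>x. ln (max ((cmod (of_real \<omega>1 * G1 x))\<^sup>2) ((cmod (of_real \<omega>2 * G2 x * G3 x))\<^sup>2))"
    let ?R = "\<lambda>x. ln (1 - \<alpha>) + ln (X1 x) + ln (max 1 (X2 x * X3 x / (?k * X1 x)))"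
    have intR: "integrable M ?R" using E(1) E0 lnX by simp
    have "expectation ?L = expectation ?R" by (rule integral_cong_AE) (use eq in simp_all)
    also have "\<dots> = ln (1 - \<alpha>) - euler_mascheroni + exp ?k * exp_integral_E1 ?k"
      using E E0 lnX by (simp add: prob_space)
    finally have EL: "expectation ?L
        = ln (1 - \<alpha>) - euler_mascheroni + exp ?k * exp_integral_E1 ?k" .
    have int: "integrable M ?L"
      using intR by (rule integrable_cong_AE_imp) (use eq in auto)
    have nz: "AE x in M. of_real \<omega>1 * G1 x \<noteq> 0 \<or> of_real \<omega>2 * G2 x * G3 x \<noteq> 0"
      using Xpos(1) by eventually_elim (use \<omega> in \<open>auto simp: X1_def\<close>)
    note ** = ln_cmod_add_gaussian[OF G1G2G3 G(3) nz int]
    have S': "S x = of_real \<omega>1 * G1 x + of_real \<omega>2 * G2 x * G3 x" for x by (simp add: S P_def \<omega>)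
    show "high_snr_approx C (\<lambda>\<gamma>bar. log 2 \<gamma>bar - log 2 (exp 1) * euler_mascheroni + log 2 (1 - \<alpha>)
        + log 2 (exp 1) * exp ?k * exp_integral_E1 ?k)"
    proof (rule reduce)
      show "integrable M (\<lambda>x. ln ((cmod (S x))\<^sup>2))" "AE x in M. S x \<noteq> 0"
        using ** by (simp_all add: S')
      show "expectation (\<lambda>x. ln ((cmod (S x))\<^sup>2))
          = ln (1 - \<alpha>) - euler_mascheroni + exp ?k * exp_integral_E1 ?k"
        unfolding S' **(2) EL ..
    qed (simp add: log_def add_divide_distrib diff_divide_distrib)
  next
    assume *: "\<alpha> = 0" "\<beta> = 0"
    have "\<omega>0 = 0" "\<omega>1 = 1" "\<omega>2 = 0" using * \<alpha> \<beta> \<omega>1 nonneg by (auto simp: power2_eq_1_iff)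
    \<comment> \<open>The signal is Gaussian itself, so the mean logarithm of \<open>X1\<close> is
      all that is required.\<close>
    then have S': "S x = G1 x" for x by (simp add: S P_def)
    show "high_snr_approx C (\<lambda>\<gamma>bar. log 2 \<gamma>bar - log 2 (exp 1) * euler_mascheroni)"
    proof (rule reduce)
      show "integrable M (\<lambda>x. ln ((cmod (S x))\<^sup>2))"
        "expectation (\<lambda>x. ln ((cmod (S x))\<^sup>2)) = - euler_mascheroni"
        using lnX(1,4) by (simp_all add: S' X1_def)
      show "AE x in M. S x \<noteq> 0" using Xpos(1) by eventually_elim (auto simp: S' X1_def)
    qed (simp add: log_def)
  next
    assume *: "\<alpha> = 1" "\<beta> = 0"
    have "\<omega>0 = 0" "\<omega>1 = 0" "\<omega>2 = 1" using * \<alpha> \<beta> \<omega>1 nonneg by (auto simp: power2_eq_1_iff)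
    then have S': "(cmod (S x))\<^sup>2 = X2 x * X3 x" for x
      by (simp add: S P_def X2_def X3_def norm_mult power_mult_distrib)
    \<comment> \<open>The squared modulus factorises, so its logarithm splits, and each of the two
      terms contributes \<open>- euler_mascheroni\<close>.\<close>
    have eq: "AE x in M. ln ((cmod (S x))\<^sup>2) = ln (X2 x) + ln (X3 x)"
      using Xpos(2,3) by eventually_elim (simp add: S' ln_mult)
    have int: "integrable M (\<lambda>x. ln (X2 x) + ln (X3 x))" using lnX by simp
    show "high_snr_approx C (\<lambda>\<gamma>bar. log 2 \<gamma>bar - 2 * log 2 (exp 1) * euler_mascheroni)"
    proof (rule reduce)
      show "integrable M (\<lambda>x. ln ((cmod (S x))\<^sup>2))"
        using int by (rule integrable_cong_AE_imp) (use eq in auto)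
      have "expectation (\<lambda>x. ln ((cmod (S x))\<^sup>2)) = expectation (\<lambda>x. ln (X2 x) + ln (X3 x))"
        by (rule integral_cong_AE) (use eq in simp_all)
      then show "expectation (\<lambda>x. ln ((cmod (S x))\<^sup>2)) = - 2 * euler_mascheroni"
        using lnX by simp
      show "AE x in M. S x \<noteq> 0"
        using Xpos(2,3)
      proof eventually_elim
        case (elim x)
        then have "(cmod (S x))\<^sup>2 > 0" by (simp add: S')
        then show ?case by auto
      qed
    qed (simp add: log_def)
  next
    assume *: "\<alpha> = 0" "\<beta> = 1"
    have "\<omega>1 = 0" "\<omega>2 = 0" using * \<alpha> \<beta> \<omega>1 nonneg by auto
    then have S': "S x = P x" for x by (simp add: S)
    show "high_snr_approx C (\<lambda>\<gamma>bar. log 2 \<gamma>bar)"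
    proof (rule reduce)
      show "integrable M (\<lambda>x. ln ((cmod (S x))\<^sup>2))" "expectation (\<lambda>x. ln ((cmod (S x))\<^sup>2)) = 0"
        by (simp_all add: S' P *)
      show "AE x in M. S x \<noteq> 0"
        using P * by (intro AE_I2) (metis S' norm_zero power_zero_numeral zero_neq_one)
    qed simp
  qed
qed

end
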